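(* Consider the problem $$\text{(P)}\qquad \min_{x\in\mathbb{R}^n,\,z\in\mathbb{R}^m}\ \tfrac12 x^TPx+q^Tx \quad\text{s.t.}\quad Ax=z,\ z\in\mathcal{C},$$ where $P\in\mathbb{R}^{n\times n}$ is symmetric positive semidefinite, $q\in\mathbb{R}^n$, $A\in\mathbb{R}^{m\times n}$, and $\mathcal{C}\subseteq\mathbb{R}^m$ is a nonempty closed convex set that is the Cartesian product of a compact convex set and a translate of a closed convex cone. Let $(x^k,z^k,y^k)_{k\in\mathbb{N}}$ be generated by the approximate ADMM algorithm described in the context (with $\rho>0$, $\sigma>0$, $\alpha\in(0,2)$, arbitrary initial values and nonnegative summable error sequences $(\mu^k),(\nu^k)$). Then: (a) If (P) has a KKT point, then $(x^k,z^k,y^k)$ converges to a KKT point of (P). (b) In all cases the limits $\delta x\coloneqq\lim_{k\to\infty}(x^{k+1}-x^k)$ and $\delta y\coloneqq\lim_{k\to\infty}(y^{k+1}-y^k)$ exist, and: (i) if $\delta y\neq 0$, then (P) is primal infeasible and $\delta y$ is a certificate of primal infeasibility, i.e. $A^T\delta y=0$ and $S_{\mathcal{C}}(\delta y)<0$; (ii) if $\delta x\neq 0$, then (P) is dual infeasible and $\delta x$ is a certificate of dual infeasibility, i.e. $P\delta x=0$, $A\delta x\in\mathcal{C}^\infty$ and $q^T\delta x<0$; (iii) if both $\delta x\neq0$ and $\delta y\neq 0$, then (P) is both primal and dual infeasible, with $\delta y$ and $\delta x$ certificates as in (i) and (ii).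
   Context: Approximate ADMM algorithm: given $x^0\in\mathbb{R}^n$, $z^0,y^0\in\mathbb{R}^m$, parameters $\rho>0,\sigma>0,\alpha\in(0,2)$ and nonnegative summable sequences $(\mu^k)_{k\in\mathbb{N}},(\nu^k)_{k\in\mathbb{N}}$, for $k=0,1,\dots$: 1. choose $(\tilde x^{k+1},\tilde z^{k+1})$ with $\|(\tilde x^{k+1},\tilde z^{k+1})-(\hat x,\hat z)\|_2\le\mu^k$, where $(\hat x,\hat z)$ is the exact solution of the linear system $\begin{bmatrix}P+\sigma I & \rho A^T\\ \rho A & -\rho I\end{bmatrix}\begin{bmatrix}\hat x\\ \hat z\end{bmatrix}=\begin{bmatrix}\sigma x^k+\rho A^T(z^k-y^k/\rho)-q\\ 0\end{bmatrix}$; 2. $x^{k+1}=\alpha\tilde x^{k+1}+(1-\alpha)x^k$; 3. choose $z^{k+1}$ with $\|z^{k+1}-\Pi_{\mathcal{C}}(\alpha\tilde z^{k+1}+(1-\alpha)z^k+y^k/\rho)\|_2\le\nu^k$, where $\Pi_{\mathcal{C}}$ is the Euclidean projection onto $\mathcal{C}$; 4. $y^{k+1}=y^k+\rho(\alpha\tilde z^{k+1}+(1-\alpha)z^k-z^{k+1})$. A KKT point of (P) is a triple $(\bar x,\bar z,\bar y)$ with $P\bar x+q+A^T\bar y=0$, $A\bar x=\bar z$, $\bar z\in\mathcal{C}$, and $\bar y$ in the normal cone of $\mathcal{C}$ at $\bar z$. $S_{\mathcal{C}}(y)=\sup_{z\in\mathcal{C}}\langle y,z\rangle$ is the support function of $\mathcal{C}$,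 and $\mathcal{C}^\infty$ denotes the recession cone of $\mathcal{C}$. *)

theory Defs
  imports "HOL-Analysis.Analysis"
begin

definition psd_sym :: "real^'n^'n \<Rightarrow> bool" where
  "psd_sym P \<longleftrightarrow> transpose P = P \<and> (\<forall>v. 0 \<le> v \<bullet> (P *v v))"

text \<open>C is (up to the coordinate split given by an index set I) the Cartesian
product of a compact convex set B (living on the coordinates in I) and a
translate b + K of a closed convex cone K (living on the coordinates outside I).\<close>
definition compact_cone_product :: "(real^'m) set \<Rightarrow> bool" where
  "compact_cone_product C \<longleftrightarrow>
     (\<exists>I B b K. compact B \<and> convex B \<and> B \<subseteq> {v. \<forall>i. i \<notin> I \<longrightarrow> v $ i = 0}
        \<and> closed K \<and> convex K \<and> cone K \<and> K \<noteq> {} \<and> K \<subseteq> {v. \<forall>i\<in>I. v $ i = 0}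
        \<and> (\<forall>i\<in>I. b $ i = 0)
        \<and> C = {u + (b + w) | u w. u \<in> B \<and> w \<in> K})"

definition normal_cone :: "(real^'m) set \<Rightarrow> real^'m \<Rightarrow> (real^'m) set" where
  "normal_cone C z = {y. \<forall>c\<in>C. y \<bullet> (c - z) \<le> 0}"

definition support_fun :: "(real^'m) set \<Rightarrow> real^'m \<Rightarrow> ereal" where
  "support_fun C y = (SUP c\<in>C. ereal (y \<bullet> c))"

definition recession_cone :: "(real^'m) set \<Rightarrow> (real^'m) set" where
  "recession_cone C = {d. \<forall>c\<in>C. \<forall>t::real. t \<ge> 0 \<longrightarrow> c + t *\<^sub>R d \<in> C}"

definition kkt_point :: "real^'n^'n \<Rightarrow> real^'n \<Rightarrow> real^'n^'m \<Rightarrow> (real^'m) set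
    \<Rightarrow> real^'n \<Rightarrow> real^'m \<Rightarrow> real^'m \<Rightarrow> bool" where
  "kkt_point P q A C x z y \<longleftrightarrow>
     P *v x + q + transpose A *v y = 0 \<and> A *v x = z \<and> z \<in> C \<and> y \<in> normal_cone C z"

definition primal_infeasible :: "real^'n^'m \<Rightarrow> (real^'m) set \<Rightarrow> bool" where
  "primal_infeasible A C \<longleftrightarrow> \<not> (\<exists>x. A *v x \<in> C)"

text \<open>Dual infeasibility: the dual problem
  max -1/2 x'Px - S_C(y) s.t. Px + A'y = -q, y in the polar of the recession cone of C,
  has no feasible point.\<close>
definition dual_infeasible :: "real^'n^'n \<Rightarrow> real^'n \<Rightarrow> real^'n^'m \<Rightarrow> (real^'m) set \<Rightarrow> bool" where
  "dual_infeasible P q A C \<longleftrightarrow>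
     \<not> (\<exists>x y. P *v x + transpose A *v y = - q \<and> (\<forall>d\<in>recession_cone C. y \<bullet> d \<le> 0))"

end

theory Submission
  imports Defs
begin

text \<open>With \<open>v = z + y/\<rho>\<close> and the weighted norm \<open>\<sigma> |x|^2 + \<rho> |v|^2\<close> the algorithm
  is an inexact relaxed iteration \<open>s' = s - \<alpha> G s\<close> of a firmly nonexpansive \<open>G\<close> whose zeros
  are the KKT points, so Krasnoselskii--Mann convergence gives (a).
  In general the zeros of \<open>G + \<lambda> I\<close> accumulate, as \<open>\<lambda>\<close> tends to 0, at displacements of
  minimal norm \<open>g\<close> with \<open>\<langle>G t, g\<rangle> \<ge> |g|^2\<close> for all \<open>t\<close>, and comparing the iterates with
  exact orbits forces \<open>G s\<^sub>k\<close> to \<open>g\<close>; hence the successive differences converge.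

  For the strict inequalities, \<open>\<delta>y \<bullet> p\<^sub>k\<close> and \<open>\<delta>x \<bullet> (P x\<^sub>k + q + A\<^sup>T y\<^sub>k)\<close> have explicit limits.
  The obstacle is to show that \<open>\<delta>y \<bullet> w\<^sub>k\<close> and \<open>y\<^sub>k \<bullet> A \<delta>x\<close> vanish in the limit, where \<open>w\<^sub>k\<close> is the
  conic part of the projection \<open>p\<^sub>k\<close>. Both are nonpositive; expanding \<open>y\<^sub>k \<bullet> w\<^sub>k = 0\<close> around
  \<open>k \<delta>y\<close> and \<open>k A \<delta>x\<close>, and using that the residuals of the optimality system converge
  while \<open>P\<close> is positive semidefinite, bounds their sum from below by \<open>o(1)\<close>.\<close>

subsection \<open>Firmly nonexpansive operators\<close>

definition firmly_nonexpansive :: "('a::real_inner \<Rightarrow> 'a) \<Rightarrow> bool" where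
  "firmly_nonexpansive G \<longleftrightarrow> (\<forall>s t. (norm (G s - G t))\<^sup>2 \<le> (G s - G t) \<bullet> (s - t))"

lemma firmly_nonexpansiveD:
  "firmly_nonexpansive G \<Longrightarrow> (norm (G s - G t))\<^sup>2 \<le> (G s - G t) \<bullet> (s - t)"
  by (simp add: firmly_nonexpansive_def)

lemma firmly_nonexpansive_lipschitz:
  assumes "firmly_nonexpansive G"
  shows "norm (G s - G t) \<le> norm (s - t)"
proof -
  have "norm (G s - G t) * norm (G s - G t) \<le> norm (G s - G t) * norm (s - t)"
    using firmly_nonexpansiveD[OF assms, of s t] norm_cauchy_schwarz[of "G s - G t" "s - t"]
    by (simp add: power2_eq_square)
  then show ?thesis
    by (cases "norm (G s - G t) = 0") (auto simp: mult_le_cancel_left)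
qed

lemma firmly_nonexpansive_tendsto:
  assumes "firmly_nonexpansive G" "(f \<longlongrightarrow> l) F"
  shows "((\<lambda>x. G (f x)) \<longlongrightarrow> G l) F"
proof -
  have "((\<lambda>x. f x - l) \<longlongrightarrow> 0) F" using assms(2) by (simp add: LIM_zero)
  then have "((\<lambda>x. G (f x) - G l) \<longlongrightarrow> 0) F"
    by (rule Lim_transform_bound[rotated])
      (auto intro!: always_eventually firmly_nonexpansive_lipschitz[OF assms(1)])
  then show ?thesis by (rule LIM_zero_cancel)
qed

text \<open>Expanding the square produces the cross term
  \<open>- 2 * \<alpha> * ((G s - G t) \<bullet> (s - t))\<close>, which firm nonexpansiveness
  bounds by the squared gap. The surplus with factor \<open>\<alpha> * (2 - \<alpha>)\<close> later
  makes the gaps square-summable.\<close>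

lemma relaxed_step_le:
  assumes "firmly_nonexpansive G" "0 \<le> \<alpha>"
  shows "(norm ((s - \<alpha> *\<^sub>R G s) - (t - \<alpha> *\<^sub>R G t)))\<^sup>2 + \<alpha> * (2 - \<alpha>) * (norm (G s - G t))\<^sup>2
    \<le> (norm (s - t))\<^sup>2"
proof -
  have eq: "(s - \<alpha> *\<^sub>R G s) - (t - \<alpha> *\<^sub>R G t) = (s - t) - \<alpha> *\<^sub>R (G s - G t)"
    by (simp add: algebra_simps)
  have "(norm ((s - \<alpha> *\<^sub>R G s) - (t - \<alpha> *\<^sub>R G t)))\<^sup>2
      = (norm (s - t))\<^sup>2 - 2 * (\<alpha> * ((G s - G t) \<bullet> (s - t))) + \<alpha>\<^sup>2 * (norm (G s - G t))\<^sup>2"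
    unfolding eq power2_norm_eq_inner
    by (simp add: inner_diff_left inner_diff_right power2_eq_square inner_commute algebra_simps)
  moreover have "\<alpha> * (norm (G s - G t))\<^sup>2 \<le> \<alpha> * ((G s - G t) \<bullet> (s - t))"
    using firmly_nonexpansiveD[OF assms(1)] assms(2) by (intro mult_left_mono)
  ultimately show ?thesis by (simp add: algebra_simps power2_eq_square)
qed

lemma relaxed_step_nonexpansive:
  assumes "firmly_nonexpansive G" "0 \<le> \<alpha>" "\<alpha> \<le> 2"
  shows "norm ((s - \<alpha> *\<^sub>R G s) - (t - \<alpha> *\<^sub>R G t)) \<le> norm (s - t)"
proof -
  have "0 \<le> \<alpha> * (2 - \<alpha>) * (norm (G s - G t))\<^sup>2" using assms by simp
  with relaxed_step_le[OF assms(1,2), of s t]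
  show ?thesis by (intro power2_le_imp_le[OF _ norm_ge_zero]) linarith
qed

section \<open>Displacements of minimal norm\<close>

text \<open>The equation is equivalent to \<open>t\<close> being a fixed point of
  \<open>(t - G t) / (1 + l)\<close>, a contraction because \<open>t - G t\<close> is nonexpansive;
  Banach's theorem applies.\<close>

lemma regularised_zero:
  fixes G :: "'a::euclidean_space \<Rightarrow> 'a"
  assumes G: "firmly_nonexpansive G" and "l > 0"
  shows "\<exists>t. G t = - l *\<^sub>R t"
proof -
  define f where "f t = (1 / (1 + l)) *\<^sub>R (t - G t)" for t
  have lip: "dist (f s) (f t) \<le> (1 / (1 + l)) * dist s t" for s t
  proof -
    have "dist (f s) (f t) = (1 / (1 + l)) * norm ((s - G s) - (t - G t))"
      using \<open>l > 0\<close> by (simp add: f_def dist_norm flip: scaleR_diff_right)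
    also have "\<dots> \<le> (1 / (1 + l)) * dist s t"
      using relaxed_step_nonexpansive[OF G, of 1 s t] \<open>l > 0\<close>
      by (intro mult_left_mono) (auto simp: dist_norm)
    finally show ?thesis .
  qed
  have "\<exists>!t. f t = t"
    by (rule banach_fix_type[of "1 / (1 + l)"]) (use \<open>l > 0\<close> lip in auto)
  then obtain t where "f t = t" by blast
  then have "(1 + l) *\<^sub>R f t = (1 + l) *\<^sub>R t" by simp
  then have "t - G t = (1 + l) *\<^sub>R t" using \<open>l > 0\<close> by (simp add: f_def)
  then have "G t = - l *\<^sub>R t" by (simp add: algebra_simps eq_neg_iff_add_eq_0)
  then show ?thesis by blast
qed

text \<open>Tikhonov regularisation: \<open>g\<close> is a cluster point of the values of
  \<open>G\<close> at the zeros of \<open>G + l n I\<close>. The first property is the variational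
  inequality of a minimal-norm element, the second says that its norm is approached by values of
  \<open>G\<close>.\<close>

lemma minimal_displacement:
  fixes G :: "'a::euclidean_space \<Rightarrow> 'a"
  assumes G: "firmly_nonexpansive G"
  obtains g where "\<And>t. g \<bullet> g \<le> G t \<bullet> g" "\<And>e. e > 0 \<Longrightarrow> \<exists>t. norm (G t) < norm g + e"
proof -
  define l where "l n = 1 / real (Suc n)" for n
  have lpos: "l n > 0" for n by (simp add: l_def)
  have "\<forall>n. \<exists>t. G t = - l n *\<^sub>R t"
    using regularised_zero[OF G lpos] by blast
  then obtain t where t: "\<And>n. G (t n) = - l n *\<^sub>R t n" by metis
  define g where "g n = G (t n)" for n
  \<comment> \<open>Monotonicity of \<open>G\<close> between \<open>t n\<close> and
    \<open>u\<close>, with \<open>t n = - g n / l n\<close> substituted and the result multiplied by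
    \<open>l n\<close>. The case \<open>u = 0\<close> bounds \<open>g\<close>; letting
    \<open>l n\<close> tend to 0 gives the variational inequality.\<close>
  have key: "(g n - G u) \<bullet> g n \<le> - l n * ((g n - G u) \<bullet> u)" for n u
  proof -
    have tn: "t n = - (1 / l n) *\<^sub>R g n" using t[of n] lpos[of n] by (simp add: g_def)
    have "0 \<le> (norm (G (t n) - G u))\<^sup>2" by simp
    also have "\<dots> \<le> (g n - G u) \<bullet> (t n - u)"
      using firmly_nonexpansiveD[OF G, of "t n" u] by (simp add: g_def)
    also have "\<dots> = - (1 / l n) * ((g n - G u) \<bullet> g n) - (g n - G u) \<bullet> u"
      by (subst tn) (simp add: inner_diff_right)
    finally have "0 \<le> l n * (- (1 / l n) * ((g n - G u) \<bullet> g n) - (g n - G u) \<bullet> u)"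
      using lpos[of n] by simp
    also have "\<dots> = - ((g n - G u) \<bullet> g n) - l n * ((g n - G u) \<bullet> u)"
      using lpos[of n] by (simp add: field_simps)
    finally show ?thesis by simp
  qed
  have bnd: "norm (g n) \<le> norm (G 0)" for n
  proof -
    have "g n \<bullet> g n \<le> G 0 \<bullet> g n" using key[of n 0] by (simp add: inner_diff_left)
    also have "\<dots> \<le> norm (G 0) * norm (g n)" by (rule norm_cauchy_schwarz)
    finally have "norm (g n) * norm (g n) \<le> norm (G 0) * norm (g n)"
      by (simp add: power2_norm_eq_inner[symmetric] power2_eq_square)
    then show ?thesis by (cases "norm (g n) = 0") (auto simp: mult_le_cancel_right)
  qed
  then have "bounded (range g)" by (auto simp: bounded_iff)
  then obtain g0 r where r: "strict_mono r" and lim: "(g \<circ> r) \<longlonglongrightarrow> g0"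
    using bounded_imp_convergent_subsequence by blast
  have lim': "(\<lambda>n. g (r n)) \<longlonglongrightarrow> g0" using lim by (simp add: o_def)
  have l0: "l \<longlonglongrightarrow> 0" unfolding l_def by (rule LIMSEQ_Suc[OF lim_1_over_n])
  have l0': "(\<lambda>n. l (r n)) \<longlonglongrightarrow> 0" using LIMSEQ_subseq_LIMSEQ[OF l0 r] by (simp add: o_def)
  show thesis
  proof
    show "g0 \<bullet> g0 \<le> G u \<bullet> g0" for u
    proof -
      \<comment> \<open>The factor \<open>- 0\<close> is the limit of \<open>- l (r n)\<close>, left
        visible so that both sides are limits of the two sides of \<open>key\<close>.\<close>
      have "(g0 - G u) \<bullet> g0 \<le> - 0 * ((g0 - G u) \<bullet> u)"
        by (rule LIMSEQ_le[of "\<lambda>n. (g (r n) - G u) \<bullet> g (r n)" _ "\<lambda>n. - l (r n) * ((g (r n) - G u) \<bullet> u)"])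
          (intro tendsto_intros lim' l0', intro tendsto_intros lim' l0', use key in blast)
      then show ?thesis by (simp add: inner_diff_left)
    qed
    show "\<exists>t. norm (G t) < norm g0 + e" if "e > 0" for e
    proof -
      have "(\<lambda>n. norm (g (r n))) \<longlonglongrightarrow> norm g0" by (intro tendsto_intros lim')
      then have "eventually (\<lambda>n. norm (g (r n)) < norm g0 + e) sequentially"
        by (rule order_tendstoD) (use that in simp)
      then show ?thesis unfolding g_def by (auto simp: eventually_sequentially)
    qed
  qed
qed

section \<open>Inexact orbits of the relaxed iteration\<close>

text \<open>Against an exact orbit \<open>t\<close>, each inexact step can increase the distance by
  at most \<open>\<epsilon> n\<close>. Telescoping the squared distances then makes the surplus of
  \<open>relaxed_step_le\<close> summable.\<close>

lemma inexact_orbit_gap: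
  fixes G :: "'a::euclidean_space \<Rightarrow> 'a"
  assumes G: "firmly_nonexpansive G" and \<alpha>: "0 < \<alpha>" "\<alpha> < 2"
    and s: "\<And>n. norm (s (Suc n) - (s n - \<alpha> *\<^sub>R G (s n))) \<le> \<epsilon> n" and \<epsilon>: "summable \<epsilon>"
    and t: "\<And>n. t (Suc n) = t n - \<alpha> *\<^sub>R G (t n)"
  shows "(\<lambda>n. G (s n) - G (t n)) \<longlonglongrightarrow> 0"
    and "norm (s (n + k) - t (n + k)) \<le> norm (s n - t n) + (\<Sum>j. \<epsilon> (n + j))"
proof -
  let ?T = "\<lambda>u. u - \<alpha> *\<^sub>R G u"
  have \<epsilon>0: "0 \<le> \<epsilon> n" for n using s[of n] norm_ge_zero order_trans by blast
  have stp: "norm (s (Suc n) - t (Suc n)) \<le> norm (?T (s n) - ?T (t n)) + \<epsilon> n" for n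
  proof -
    have "norm (s (Suc n) - t (Suc n)) = norm ((s (Suc n) - ?T (s n)) + (?T (s n) - ?T (t n)))"
      unfolding t by (simp add: algebra_simps)
    also have "\<dots> \<le> \<epsilon> n + norm (?T (s n) - ?T (t n))"
      by (intro norm_triangle_le add_right_mono s)
    finally show ?thesis by simp
  qed
  have ne: "norm (?T (s n) - ?T (t n)) \<le> norm (s n - t n)" for n
    using relaxed_step_nonexpansive[OF G, of \<alpha>] \<alpha> by simp
  have sums: "norm (s (n + k) - t (n + k)) \<le> norm (s n - t n) + (\<Sum>j<k. \<epsilon> (n + j))" for n k
  proof (induction k)
    case (Suc k)
    then show ?case using stp[of "n + k"] ne[of "n + k"] by simp
  qed simp
  have bound: "norm (s (n + k) - t (n + k)) \<le> norm (s n - t n) + (\<Sum>j. \<epsilon> (n + j))" for n k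
  proof -
    have "summable (\<lambda>j. \<epsilon> (n + j))" using \<epsilon> by (simp add: summable_iff_shift add.commute[of n])
    then have "(\<Sum>j<k. \<epsilon> (n + j)) \<le> (\<Sum>j. \<epsilon> (n + j))"
      by (rule sum_le_suminf) (use \<epsilon>0 in auto)
    with sums[of n k] show ?thesis by simp
  qed
  then show "norm (s (n + k) - t (n + k)) \<le> norm (s n - t n) + (\<Sum>j. \<epsilon> (n + j))" .
  define E where "E = suminf \<epsilon>"
  define M where "M = norm (s 0 - t 0) + E"
  have M: "norm (s n - t n) \<le> M" for n using bound[of 0 n] by (simp add: M_def E_def)
  have E: "(\<Sum>i<n. \<epsilon> i) \<le> E" for n
    unfolding E_def by (rule sum_le_suminf[OF \<epsilon>]) (use \<epsilon>0 in auto)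
  have E1: "\<epsilon> n \<le> E" for n
    using E[of "Suc n"] sum_nonneg[of "{..<n}" \<epsilon>] \<epsilon>0 by simp
  define c where "c = \<alpha> * (2 - \<alpha>)"
  have c: "c > 0" using \<alpha> by (simp add: c_def)
  define a where "a n = (norm (s n - t n))\<^sup>2" for n
  \<comment> \<open>Squaring \<open>d + \<epsilon> n\<close> costs
    \<open>(2 * d + \<epsilon> n) * \<epsilon> n\<close>; since \<open>d \<le> M\<close> and
    \<open>\<epsilon> n \<le> E\<close>, this is a constant times a summable term.\<close>
  have step: "c * (norm (G (s n) - G (t n)))\<^sup>2 \<le> a n - a (Suc n) + (2 * M + E) * \<epsilon> n" for n
  proof -
    have "a (Suc n) \<le> (norm (?T (s n) - ?T (t n)) + \<epsilon> n)\<^sup>2"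
      unfolding a_def using stp by (intro power_mono) auto
    also have "\<dots> = (norm (?T (s n) - ?T (t n)))\<^sup>2 + (2 * norm (?T (s n) - ?T (t n)) + \<epsilon> n) * \<epsilon> n"
      by (simp add: power2_eq_square algebra_simps)
    also have "\<dots> \<le> (norm (?T (s n) - ?T (t n)))\<^sup>2 + (2 * M + E) * \<epsilon> n"
      using order_trans[OF ne M, of n] E1[of n] \<epsilon>0[of n]
      by (intro add_left_mono mult_right_mono) auto
    finally show ?thesis
      using relaxed_step_le[OF G, of \<alpha> "s n" "t n"] \<alpha> unfolding a_def c_def by simp
  qed
  have "summable (\<lambda>n. c * (norm (G (s n) - G (t n)))\<^sup>2)"
  proof (rule summableI_nonneg_bounded)
    have M0: "0 \<le> 2 * M + E"
      using order_trans[OF norm_ge_zero M[of 0]] E[of 0] by simp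
    fix n
    have "(\<Sum>i<n. c * (norm (G (s i) - G (t i)))\<^sup>2) \<le> (\<Sum>i<n. a i - a (Suc i) + (2 * M + E) * \<epsilon> i)"
      by (intro sum_mono step)
    also have "\<dots> = a 0 - a n + (2 * M + E) * (\<Sum>i<n. \<epsilon> i)"
      by (simp add: sum.distrib sum_distrib_left sum_lessThan_telescope')
    also have "\<dots> \<le> a 0 + (2 * M + E) * E"
      using mult_left_mono[OF E[of n] M0] zero_le_power2[of "norm (s n - t n)"]
      unfolding a_def by linarith
    finally show "(\<Sum>i<n. c * (norm (G (s i) - G (t i)))\<^sup>2) \<le> a 0 + (2 * M + E) * E" .
  qed (use c in auto)
  then have "(\<lambda>n. c * (norm (G (s n) - G (t n)))\<^sup>2) \<longlonglongrightarrow> 0" by (rule summable_LIMSEQ_zero)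
  then have "(\<lambda>n. (1/c) * (c * (norm (G (s n) - G (t n)))\<^sup>2)) \<longlonglongrightarrow> (1/c) * 0" by (rule tendsto_mult_left)
  then have "(\<lambda>n. (norm (G (s n) - G (t n)))\<^sup>2) \<longlonglongrightarrow> 0" using c by simp
  then have "(\<lambda>n. sqrt ((norm (G (s n) - G (t n)))\<^sup>2)) \<longlonglongrightarrow> sqrt 0" by (rule tendsto_real_sqrt)
  then show "(\<lambda>n. G (s n) - G (t n)) \<longlonglongrightarrow> 0" by (simp add: tendsto_norm_zero_iff)
qed

text \<open>The limit is the minimal displacement. First the norms converge, by comparison with an
  exact orbit started where \<open>norm (G t0)\<close> is nearly minimal; the variational inequality
  then upgrades this to convergence of the vectors.\<close>

lemma inexact_displacement_tendsto:
  fixes G :: "'a::euclidean_space \<Rightarrow> 'a"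
  assumes G: "firmly_nonexpansive G" and \<alpha>: "0 < \<alpha>" "\<alpha> < 2"
    and s: "\<And>n. norm (s (Suc n) - (s n - \<alpha> *\<^sub>R G (s n))) \<le> \<epsilon> n" and \<epsilon>: "summable \<epsilon>"
  obtains g where "(\<lambda>n. G (s n)) \<longlonglongrightarrow> g"
proof -
  obtain g where g: "\<And>t. g \<bullet> g \<le> G t \<bullet> g" "\<And>e. e > 0 \<Longrightarrow> \<exists>t. norm (G t) < norm g + e"
    using minimal_displacement[OF G] by blast
  have lower: "norm g \<le> norm (G u)" for u
  proof (cases "g = 0")
    case False
    have "norm g * norm g \<le> norm (G u) * norm g"
      using g(1)[of u] norm_cauchy_schwarz[of "G u" g]
      by (simp add: power2_norm_eq_inner[symmetric] power2_eq_square)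
    then show ?thesis using False by simp
  qed simp
  have lim: "(\<lambda>n. norm (G (s n))) \<longlonglongrightarrow> norm g"
  proof (rule LIMSEQ_I)
    fix e :: real assume "e > 0"
    obtain t0 where t0: "norm (G t0) < norm g + e / 2" using g(2)[of "e / 2"] \<open>e > 0\<close> by auto
    define t where "t n = ((\<lambda>u. u - \<alpha> *\<^sub>R G u) ^^ n) t0" for n
    have tS: "t (Suc n) = t n - \<alpha> *\<^sub>R G (t n)" for n by (simp add: t_def)
    have decr: "norm (G (t n)) \<le> norm (G t0)" for n
    proof (induction n)
      case (Suc n)
      \<comment> \<open>Along an exact orbit \<open>\<alpha> G\<close> is the difference of
        consecutive points, and these differences cannot grow under a nonexpansive step.\<close>
      have "\<alpha> * norm (G (t (Suc n))) = norm ((t (Suc n) - \<alpha> *\<^sub>R G (t (Suc n))) - (t n - \<alpha> *\<^sub>R G (t n)))"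
        using \<alpha> by (simp add: tS)
      also have "\<dots> \<le> norm (t (Suc n) - t n)"
        using relaxed_step_nonexpansive[OF G, of \<alpha>] \<alpha> by simp
      also have "\<dots> = \<alpha> * norm (G (t n))" using \<alpha> by (simp add: tS)
      finally show ?case using \<alpha> Suc by simp
    qed (simp add: t_def)
    have "(\<lambda>n. G (s n) - G (t n)) \<longlonglongrightarrow> 0" by (rule inexact_orbit_gap(1)[where \<alpha> = \<alpha> and \<epsilon> = \<epsilon>])
        (use G \<alpha> s \<epsilon> tS in auto)
    then obtain N where N: "\<And>n. n \<ge> N \<Longrightarrow> norm (G (s n) - G (t n)) < e / 2"
      using LIMSEQ_D[of _ 0 "e / 2"] \<open>e > 0\<close> by auto
    have "norm (norm (G (s n)) - norm g) < e" if "n \<ge> N" for n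
      using N[OF that] decr[of n] t0 lower[of "s n"] norm_triangle_sub[of "G (s n)" "G (t n)"]
      by simp
    then show "\<exists>N. \<forall>n\<ge>N. norm (norm (G (s n)) - norm g) < e" by blast
  qed
  have "(\<lambda>n. norm (G (s n) - g)) \<longlonglongrightarrow> 0"
  proof (rule tendsto_sandwich[of "\<lambda>_. 0"])
    have "(\<lambda>n. sqrt ((norm (G (s n)))\<^sup>2 - (norm g)\<^sup>2)) \<longlonglongrightarrow> sqrt ((norm g)\<^sup>2 - (norm g)\<^sup>2)"
      by (intro tendsto_intros lim)
    then show "(\<lambda>n. sqrt ((norm (G (s n)))\<^sup>2 - (norm g)\<^sup>2)) \<longlonglongrightarrow> 0" by simp
    \<comment> \<open>Expand the square and use
      \<open>g \<bullet> g \<le> G (s n) \<bullet> g\<close> for the cross term.\<close>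
    have "(norm (G (s n) - g))\<^sup>2 \<le> (norm (G (s n)))\<^sup>2 - (norm g)\<^sup>2" for n
      using g(1)[of "s n"] unfolding power2_norm_eq_inner
      by (simp add: inner_diff_left inner_diff_right inner_commute)
    then show "\<forall>\<^sub>F n in sequentially. norm (G (s n) - g) \<le> sqrt ((norm (G (s n)))\<^sup>2 - (norm g)\<^sup>2)"
      by (simp add: real_le_rsqrt)
  qed auto
  then have "(\<lambda>n. G (s n)) \<longlonglongrightarrow> g" by (simp add: tendsto_norm_zero_iff LIM_zero_iff)
  with that show thesis .
qed

text \<open>A zero of \<open>G\<close> is a constant exact orbit. Comparison with \<open>t0\<close>
  gives \<open>G (s n)\<close> tending to 0 and boundedness, so a cluster point \<open>p\<close> is
  a zero; comparison with \<open>p\<close> itself turns subsequential convergence into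
  convergence.\<close>

lemma inexact_krasnoselskii_mann:
  fixes G :: "'a::euclidean_space \<Rightarrow> 'a"
  assumes G: "firmly_nonexpansive G" and \<alpha>: "0 < \<alpha>" "\<alpha> < 2"
    and s: "\<And>n. norm (s (Suc n) - (s n - \<alpha> *\<^sub>R G (s n))) \<le> \<epsilon> n" and \<epsilon>: "summable \<epsilon>"
    and "G t0 = 0"
  obtains p where "G p = 0" "s \<longlonglongrightarrow> p"
proof -
  have gap0: "(\<lambda>n. G (s n)) \<longlonglongrightarrow> 0"
    using inexact_orbit_gap(1)[OF G \<alpha> s \<epsilon>, of "\<lambda>_. t0"] \<open>G t0 = 0\<close> by simp
  have fejer: "norm (s (n + k) - p) \<le> norm (s n - p) + (\<Sum>j. \<epsilon> (n + j))" if "G p = 0" for p n k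
    using inexact_orbit_gap(2)[OF G \<alpha> s \<epsilon>, of "\<lambda>_. p"] that by simp
  have "norm (s k) \<le> norm t0 + (norm (s 0 - t0) + suminf \<epsilon>)" for k
    using fejer[OF \<open>G t0 = 0\<close>, of 0 k] norm_triangle_sub[of "s k" t0] by simp
  then have "bounded (range s)" by (auto simp: bounded_iff)
  then obtain p r where r: "strict_mono r" and lim: "(s \<circ> r) \<longlonglongrightarrow> p"
    using bounded_imp_convergent_subsequence by blast
  have "(\<lambda>n. G (s (r n))) \<longlonglongrightarrow> G p"
    using firmly_nonexpansive_tendsto[OF G lim] by (simp add: o_def)
  moreover have "(\<lambda>n. G (s (r n))) \<longlonglongrightarrow> 0"
    using LIMSEQ_subseq_LIMSEQ[OF gap0 r] by (simp add: o_def)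
  ultimately have p: "G p = 0" by (rule LIMSEQ_unique)
  have "s \<longlonglongrightarrow> p"
  proof (rule LIMSEQ_I)
    fix e :: real assume "e > 0"
    have "(\<lambda>n. \<Sum>j. \<epsilon> (j + n)) \<longlonglongrightarrow> 0" by (rule suminf_exist_split2[OF \<epsilon>])
    then have tail: "(\<lambda>n. \<Sum>j. \<epsilon> (r n + j)) \<longlonglongrightarrow> 0"
      using LIMSEQ_subseq_LIMSEQ[OF _ r] by (fastforce simp: o_def add.commute)
    have "(\<lambda>n. norm (s (r n) - p) + (\<Sum>j. \<epsilon> (r n + j))) \<longlonglongrightarrow> norm (p - p) + 0"
      using lim by (intro tendsto_intros tail) (simp add: o_def)
    then have "eventually (\<lambda>n. norm (s (r n) - p) + (\<Sum>j. \<epsilon> (r n + j)) < e) sequentially"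
      by (rule order_tendstoD) (use \<open>e > 0\<close> in simp)
    then obtain n where n: "norm (s (r n) - p) + (\<Sum>j. \<epsilon> (r n + j)) < e"
      by (auto simp: eventually_sequentially)
    have "norm (s m - p) < e" if "m \<ge> r n" for m
      using fejer[OF p, of "r n" "m - r n"] n that by simp
    then show "\<exists>N. \<forall>m\<ge>N. norm (s m - p) < e" by blast
  qed
  with p that show thesis by blast
qed

subsection \<open>Displacement vectors as infeasibility certificates\<close>

text \<open>A Cesaro argument: the increments of \<open>f n - n d\<close> tend to 0, so it grows
  slower than linearly.\<close>

lemma difference_quotient_tendsto:
  fixes f :: "nat \<Rightarrow> 'a::real_normed_vector"
  assumes "(\<lambda>n. f (Suc n) - f n) \<longlonglongrightarrow> d"
  shows "(\<lambda>n. inverse (real n) *\<^sub>R (f n - real n *\<^sub>R d)) \<longlonglongrightarrow> 0"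
proof (rule LIMSEQ_I)
  fix e :: real assume "e > 0"
  define h where "h n = f n - real n *\<^sub>R d" for n
  obtain N where N: "\<And>n. n \<ge> N \<Longrightarrow> norm (f (Suc n) - f n - d) < e / 2"
    using LIMSEQ_D[OF assms, of "e / 2"] \<open>e > 0\<close> by auto
  have hb: "norm (h (N + k)) \<le> norm (h N) + real k * (e / 2)" for k
  proof (induction k)
    case (Suc k)
    have "h (N + Suc k) = h (N + k) + (f (Suc (N + k)) - f (N + k) - d)"
      by (simp add: h_def algebra_simps)
    then have "norm (h (N + Suc k)) \<le> norm (h (N + k)) + norm (f (Suc (N + k)) - f (N + k) - d)"
      by (simp only: norm_triangle_ineq)
    also have "\<dots> \<le> (norm (h N) + real k * (e / 2)) + e / 2"
      using N[of "N + k"] Suc by (intro add_mono) auto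
    finally show ?case by (simp add: field_simps)
  qed simp
  \<comment> \<open>Beyond \<open>M\<close> the fixed initial term \<open>norm (h N)\<close> is less
    than \<open>n * e / 2\<close>; the increments after \<open>N\<close> supply the other
    half.\<close>
  obtain M where M: "real M > 2 * norm (h N) / e" using reals_Archimedean2 by blast
  have "norm (inverse (real n) *\<^sub>R h n - 0) < e" if "n \<ge> max (max N M) 1" for n
  proof -
    have "norm (h n) \<le> norm (h N) + real (n - N) * (e / 2)" using hb[of "n - N"] that by simp
    also have "\<dots> \<le> norm (h N) + real n * (e / 2)" using \<open>e > 0\<close> by (simp add: mult_right_mono)
    also have "norm (h N) < real n * (e / 2)"
    proof -
      have "2 * norm (h N) / e < real n" using M that by simp
      then show ?thesis using \<open>e > 0\<close> by (simp add: field_simps)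
    qed
    finally have "norm (h n) < real n * e" by (simp add: algebra_simps)
    then show ?thesis using that by (simp add: field_simps)
  qed
  then show "\<exists>N. \<forall>n\<ge>N. norm (inverse (real n) *\<^sub>R (f n - real n *\<^sub>R d) - 0) < e"
    unfolding h_def by blast
qed

lemma tendsto_inner_bounded:
  fixes f g :: "nat \<Rightarrow> 'a::real_inner"
  assumes "f \<longlonglongrightarrow> 0" "\<And>n. norm (g n) \<le> M"
  shows "(\<lambda>n. f n \<bullet> g n) \<longlonglongrightarrow> 0"
proof (rule Lim_null_comparison)
  show "(\<lambda>n. norm (f n) * M) \<longlonglongrightarrow> 0"
    by (rule tendsto_mult_left_zero) (use assms(1) in \<open>simp add: tendsto_norm_zero_iff\<close>)
  show "\<forall>\<^sub>F n in sequentially. norm (f n \<bullet> g n) \<le> norm (f n) * M"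
    by (intro always_eventually allI order_trans[OF Cauchy_Schwarz_ineq2[folded real_norm_def]]
        mult_left_mono assms(2)) simp
qed

lemma inner_transpose_mult:
  fixes A :: "real^'n^'m"
  shows "(transpose A *v y) \<bullet> x = y \<bullet> (A *v x)"
  by (simp add: transpose_matrix_vector dot_lmul_matrix)

lemma tendsto_matrix_vector_mult:
  fixes A :: "real^'n^'m"
  assumes "(f \<longlongrightarrow> l) F"
  shows "((\<lambda>x. A *v f x) \<longlongrightarrow> A *v l) F"
  by (rule bounded_linear.tendsto[OF matrix_vector_mul_bounded_linear assms])

lemma psd_sym_inner: "psd_sym P \<Longrightarrow> (P *v x) \<bullet> y = x \<bullet> (P *v y)"
  by (metis inner_transpose_mult psd_sym_def)

text \<open>Along \<open>v + t P v\<close> the form is a nonnegative quadratic in \<open>t\<close>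
  without constant term, so its linear coefficient \<open>2 (w \<bullet> w)\<close> must
  vanish.\<close>

lemma psd_form_zero_imp_kernel:
  assumes "psd_sym P" "v \<bullet> (P *v v) = 0"
  shows "P *v v = 0"
proof -
  define w where "w = P *v v"
  have nn: "0 \<le> u \<bullet> (P *v u)" for u using assms(1) by (simp add: psd_sym_def)
  define c where "c = w \<bullet> (P *v w)"
  have ineq: "0 \<le> 2 * t * (w \<bullet> w) + t * t * c" for t
  proof -
    have "0 \<le> (v + t *\<^sub>R w) \<bullet> (P *v (v + t *\<^sub>R w))" by (rule nn)
    also have "\<dots> = v \<bullet> (P *v v) + t * (v \<bullet> (P *v w)) + t * (w \<bullet> (P *v v)) + t * t * c"
      by (simp add: c_def matrix_vector_right_distrib matrix_vector_mult_scaleR inner_simps algebra_simps)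
    also have "\<dots> = 2 * t * (w \<bullet> w) + t * t * c"
      using assms(2) by (simp add: w_def flip: psd_sym_inner[OF assms(1), of v])
    finally show ?thesis .
  qed
  have "c \<ge> 0" using nn by (simp add: c_def)
  have "\<not> w \<bullet> w > 0"
  proof
    assume pos: "w \<bullet> w > 0"
    \<comment> \<open>A negative \<open>t\<close> small enough for the linear term to dominate;
      \<open>c + 1\<close> keeps the denominator positive when \<open>c = 0\<close>.\<close>
    define t where "t = - ((w \<bullet> w) / (c + 1))"
    have "t * c \<ge> - (w \<bullet> w)"
      using pos \<open>c \<ge> 0\<close> by (simp add: t_def field_simps)
    then have "2 * (w \<bullet> w) + t * c > 0" using pos by linarith
    moreover have "t < 0" using pos \<open>c \<ge> 0\<close> by (simp add: t_def)
    ultimately have "t * (2 * (w \<bullet> w) + t * c) < 0" by (rule mult_neg_pos[rotated])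
    then show False using ineq[of t] by (simp add: algebra_simps)
  qed
  then show ?thesis by (simp add: w_def inner_gt_zero_iff)
qed

text \<open>\<open>c + t d\<close> is the limit of convex combinations of \<open>c\<close> and
  \<open>p n\<close> with weight \<open>t / n\<close> on \<open>p n\<close>, admissible once
  \<open>n > t\<close>.\<close>

lemma recession_cone_limit:
  assumes "closed C" "convex C" "\<And>n. p n \<in> C"
    and "(\<lambda>n. inverse (real n) *\<^sub>R p n) \<longlonglongrightarrow> d"
  shows "d \<in> recession_cone C"
  unfolding recession_cone_def
proof clarify
  fix c and t :: real assume "c \<in> C" "t \<ge> 0"
  have i0: "(\<lambda>n. inverse (real n)) \<longlonglongrightarrow> 0" by (rule lim_inverse_n)
  let ?f = "\<lambda>n. (1 - t * inverse (real n)) *\<^sub>R c + t *\<^sub>R (inverse (real n) *\<^sub>R p n)"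
  have lim: "?f \<longlonglongrightarrow> (1 - t * 0) *\<^sub>R c + t *\<^sub>R d"
    by (intro tendsto_intros i0 assms(4))
  obtain N where N: "real N > t" using reals_Archimedean2 by blast
  have "?f n \<in> C" if "n \<ge> N" for n
  proof -
    have "real n > t" using N that by simp
    then have "t * inverse (real n) \<le> 1" "t * inverse (real n) \<ge> 0"
      using \<open>t \<ge> 0\<close> by (simp_all add: field_simps)
    then have "(1 - t * inverse (real n)) *\<^sub>R c + (t * inverse (real n)) *\<^sub>R p n \<in> C"
      by (intro convexD[OF assms(2) \<open>c \<in> C\<close> assms(3)]) auto
    then show ?thesis by simp
  qed
  then have "eventually (\<lambda>n. ?f n \<in> C) sequentially" by (auto simp: eventually_sequentially)
  from Lim_in_closed_set[OF assms(1) this sequentially_bot lim]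
  show "c + t *\<^sub>R d \<in> C" by simp
qed

text \<open>Convergent residuals have vanishing differences, which gives the increments of
  \<open>p\<close> and \<open>P dx + A^T dy = 0\<close>. Pairing this equation with
  \<open>dx\<close> yields two nonnegative terms with sum 0: one by semidefiniteness, the other by
  monotonicity of the normal cone.\<close>

lemma displacement_relations:
  fixes A :: "real^'n^'m"
  assumes P: "psd_sym P" and C: "closed C" "convex C"
    and pC: "\<And>k. p k \<in> C" and yN: "\<And>k. y k \<in> normal_cone C (p k)"
    and dx: "(\<lambda>k. x (Suc k) - x k) \<longlonglongrightarrow> dx"
    and dy: "(\<lambda>k. y (Suc k) - y k) \<longlonglongrightarrow> dy"
    and primal: "(\<lambda>k. A *v x k - p k) \<longlonglongrightarrow> a"
    and dual: "(\<lambda>k. P *v x k + q + transpose A *v y k) \<longlonglongrightarrow> b"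
  shows "(\<lambda>k. p (Suc k) - p k) \<longlonglongrightarrow> A *v dx" "A *v dx \<in> recession_cone C"
    "P *v dx = 0" "transpose A *v dy = 0"
proof -
  have "(\<lambda>k. A *v (x (Suc k) - x k) - ((A *v x (Suc k) - p (Suc k)) - (A *v x k - p k)))
      \<longlonglongrightarrow> A *v dx - (a - a)"
    by (intro tendsto_intros tendsto_matrix_vector_mult dx primal LIMSEQ_Suc[OF primal])
  then show dp: "(\<lambda>k. p (Suc k) - p k) \<longlonglongrightarrow> A *v dx"
    by (simp add: matrix_vector_mult_diff_distrib algebra_simps)
  have "(\<lambda>n. inverse (real n) *\<^sub>R (p n - real n *\<^sub>R (A *v dx)) + A *v dx) \<longlonglongrightarrow> 0 + A *v dx"
    by (intro tendsto_intros difference_quotient_tendsto dp)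
  \<comment> \<open>Only eventual equality: at \<open>n = 0\<close> the convention
    \<open>inverse 0 = 0\<close> breaks the cancellation.\<close>
  moreover have "\<forall>\<^sub>F n in sequentially. inverse (real n) *\<^sub>R (p n - real n *\<^sub>R (A *v dx)) + A *v dx
      = inverse (real n) *\<^sub>R p n"
    using eventually_gt_at_top[of 0] by eventually_elim (simp add: scaleR_diff_right)
  ultimately have "(\<lambda>n. inverse (real n) *\<^sub>R p n) \<longlonglongrightarrow> A *v dx"
    by (simp add: tendsto_cong)
  with C pC show "A *v dx \<in> recession_cone C" by (rule recession_cone_limit)
  let ?r = "\<lambda>k. P *v x k + q + transpose A *v y k"
  have "(\<lambda>k. ?r (Suc k) - ?r k) \<longlonglongrightarrow> b - b"
    by (intro tendsto_intros LIMSEQ_Suc[OF dual] dual)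
  then have "(\<lambda>k. P *v (x (Suc k) - x k) + transpose A *v (y (Suc k) - y k)) \<longlonglongrightarrow> 0"
    by (simp add: matrix_vector_mult_diff_distrib algebra_simps)
  moreover have "(\<lambda>k. P *v (x (Suc k) - x k) + transpose A *v (y (Suc k) - y k))
      \<longlonglongrightarrow> P *v dx + transpose A *v dy"
    by (intro tendsto_intros tendsto_matrix_vector_mult dx dy)
  ultimately have sum0: "P *v dx + transpose A *v dy = 0" using LIMSEQ_unique by blast
  have "0 \<le> dy \<bullet> (A *v dx)"
  proof (rule LIMSEQ_le_const)
    show "(\<lambda>k. (y (Suc k) - y k) \<bullet> (p (Suc k) - p k)) \<longlonglongrightarrow> dy \<bullet> (A *v dx)"
      by (intro tendsto_intros dy dp)
    \<comment> \<open>Sum of the normal-cone inequalities at \<open>p k\<close> and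
      \<open>p (Suc k)\<close>, each tested at the other point.\<close>
    have "0 \<le> (y (Suc k) - y k) \<bullet> (p (Suc k) - p k)" for k
    proof -
      have "y k \<bullet> (p (Suc k) - p k) \<le> 0" "y (Suc k) \<bullet> (p k - p (Suc k)) \<le> 0"
        using yN pC unfolding normal_cone_def by blast+
      then show ?thesis by (simp add: inner_diff_left inner_diff_right)
    qed
    then show "\<exists>N. \<forall>n\<ge>N. 0 \<le> (y (Suc n) - y n) \<bullet> (p (Suc n) - p n)" by blast
  qed
  moreover have "dx \<bullet> (P *v dx) + dy \<bullet> (A *v dx) = 0"
    using arg_cong[OF sum0, of "\<lambda>v. v \<bullet> dx"]
    by (simp only: inner_add_left inner_transpose_mult inner_zero_left inner_commute[of "P *v dx"])
  moreover have "0 \<le> dx \<bullet> (P *v dx)" using P by (simp add: psd_sym_def)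
  ultimately show "P *v dx = 0" by (intro psd_form_zero_imp_kernel[OF P]) linarith
  with sum0 show "transpose A *v dy = 0" by simp
qed

text \<open>Turns the limiting residuals \<open>a\<close> and \<open>b\<close> into certificate
  values. Both claims are limits of pairings with \<open>dy\<close> and \<open>dx\<close> whose only
  uncontrolled terms are \<open>dy \<bullet> w k\<close> and \<open>y k \<bullet> dz\<close>, shown
  below to vanish.\<close>

lemma displacement_certificate_bounds:
  fixes A :: "real^'n^'m" and B K :: "(real^'m) set"
  assumes P: "psd_sym P" and C: "closed C" "convex C"
    and split: "C = {u + w | u w. u \<in> B \<and> w \<in> K}" "bounded B" "cone K"
    and pC: "\<And>k. p k \<in> C" and yN: "\<And>k. y k \<in> normal_cone C (p k)"
    and dx: "(\<lambda>k. x (Suc k) - x k) \<longlonglongrightarrow> dx"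
    and dy: "(\<lambda>k. y (Suc k) - y k) \<longlonglongrightarrow> dy"
    and primal: "(\<lambda>k. A *v x k - p k) \<longlonglongrightarrow> a"
    and dual: "(\<lambda>k. P *v x k + q + transpose A *v y k) \<longlonglongrightarrow> b"
  shows "c \<in> C \<Longrightarrow> dy \<bullet> c \<le> - (dy \<bullet> a)" and "q \<bullet> dx = b \<bullet> dx"
proof -
  note rel = displacement_relations[OF P C pC yN dx dy primal dual]
  define dz where "dz = A *v dx"
  obtain M where M: "\<And>u. u \<in> B \<Longrightarrow> norm u \<le> M" using split(2) by (auto simp: bounded_iff)
  have "\<forall>k. \<exists>u w. u \<in> B \<and> w \<in> K \<and> p k = u + w" using pC split(1) by blast
  then obtain u w where u: "\<And>k. u k \<in> B" and w: "\<And>k. w k \<in> K" and p: "\<And>k. p k = u k + w k"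
    by metis
  have ycone: "y k \<bullet> v \<le> 0" if "v \<in> K" for k v
  proof (rule ccontr)
    assume "\<not> ?thesis"
    then have pos: "y k \<bullet> v > 0" by simp
    \<comment> \<open>Moving this far along \<open>v\<close> gains
      \<open>\<bar>y k \<bullet> w k\<bar> + 1\<close>, more than the
      \<open>y k \<bullet> w k\<close> lost by dropping \<open>w k\<close>, contradicting
      normality.\<close>
    define t where "t = (\<bar>y k \<bullet> w k\<bar> + 1) / (y k \<bullet> v)"
    have "t \<ge> 0" using pos by (simp add: t_def)
    then have "t *\<^sub>R v \<in> K" using split(3) that by (auto simp: cone_def)
    then have "u k + t *\<^sub>R v \<in> C" using u split(1) by blast
    then have "y k \<bullet> (u k + t *\<^sub>R v - p k) \<le> 0" using yN[of k] by (auto simp: normal_cone_def)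
    then have "t * (y k \<bullet> v) \<le> y k \<bullet> w k" by (simp add: p inner_diff_right inner_add_right)
    moreover have "t * (y k \<bullet> v) = \<bar>y k \<bullet> w k\<bar> + 1" using pos by (simp add: t_def)
    ultimately show False by linarith
  qed
  have yw: "y k \<bullet> w k = 0" for k
  proof -
    \<comment> \<open>Comparison with the apex of the cone gives
      \<open>y k \<bullet> w k \<ge> 0\<close>; \<open>ycone\<close> gives the reverse
      inequality.\<close>
    have "0 *\<^sub>R w k \<in> K" using split(3) w[of k] unfolding cone_def by (metis order_refl)
    then have "u k + 0 *\<^sub>R w k \<in> C" using u split(1) by blast
    then have "y k \<bullet> (u k + 0 *\<^sub>R w k - p k) \<le> 0" using yN[of k] by (auto simp: normal_cone_def)
    then show ?thesis using ycone[OF w, of k k] by (simp add: p inner_diff_right inner_add_right)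
  qed
  have yB: "y k \<bullet> v \<le> y k \<bullet> u k" if "v \<in> B" for k v
  proof -
    have "v + w k \<in> C" using that w split(1) by blast
    then have "y k \<bullet> (v + w k - p k) \<le> 0" using yN[of k] by (auto simp: normal_cone_def)
    then show ?thesis by (simp add: p inner_diff_right inner_add_right)
  qed
  \<comment> \<open>\<open>s\<close> and \<open>\<xi>\<close> are the deviations of \<open>y\<close>
    and \<open>x\<close> from linear growth; divided by \<open>k\<close> they tend to 0.\<close>
  define s where "s k = y k - real k *\<^sub>R dy" for k
  define \<xi> where "\<xi> k = x k - real k *\<^sub>R dx" for k
  define i where "i k = inverse (real k)" for k
  have is0: "(\<lambda>k. i k *\<^sub>R s k) \<longlonglongrightarrow> 0" unfolding i_def s_def by (rule difference_quotient_tendsto[OF dy])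
  have i\<xi>0: "(\<lambda>k. i k *\<^sub>R \<xi> k) \<longlonglongrightarrow> 0" unfolding i_def \<xi>_def by (rule difference_quotient_tendsto[OF dx])
  have i0: "i k \<ge> 0" for k by (simp add: i_def)
  have iy: "i k *\<^sub>R y k = i k *\<^sub>R s k + dy" if "k \<ge> 1" for k
    using that by (simp add: i_def s_def scaleR_diff_right)
  \<comment> \<open>\<open>dy\<close> is the limit of \<open>y k / k\<close>, so it inherits the
    sign of \<open>y k\<close> on the cone.\<close>
  have dyK: "dy \<bullet> v \<le> 0" if "v \<in> K" for v
  proof (rule LIMSEQ_le_const)
    show "(\<lambda>k. - ((i k *\<^sub>R s k) \<bullet> v)) \<longlonglongrightarrow> 0"
      using tendsto_minus[OF tendsto_inner_bounded[OF is0, of "\<lambda>_. v" "norm v"]] by simp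
    have "dy \<bullet> v \<le> - ((i k *\<^sub>R s k) \<bullet> v)" if "k \<ge> 1" for k
    proof -
      have "(i k *\<^sub>R s k + dy) \<bullet> v = i k * (y k \<bullet> v)" unfolding iy[OF that, symmetric] by simp
      also have "\<dots> \<le> 0" using ycone[OF \<open>v \<in> K\<close>] i0 by (simp add: mult_nonneg_nonpos)
      finally show ?thesis by (simp add: inner_add_left)
    qed
    then show "\<exists>N. \<forall>k\<ge>N. dy \<bullet> v \<le> - ((i k *\<^sub>R s k) \<bullet> v)" by blast
  qed
  have dzy: "y k \<bullet> dz \<le> 0" for k
  proof -
    have "p k + 1 *\<^sub>R dz \<in> C" using rel(2) pC[of k] unfolding recession_cone_def dz_def by (blast intro: zero_le_one)
    then have "y k \<bullet> (p k + 1 *\<^sub>R dz - p k) \<le> 0" using yN[of k] unfolding normal_cone_def by blast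
    then show ?thesis by simp
  qed
  define ra where "ra k = A *v x k - p k" for k
  define rb where "rb k = P *v x k + q + transpose A *v y k" for k
  have ra: "ra \<longlonglongrightarrow> a" using primal by (simp add: ra_def[abs_def])
  have rb: "rb \<longlonglongrightarrow> b" using dual by (simp add: rb_def[abs_def])
  obtain Ma where Ma: "\<And>k. norm (ra k) \<le> Ma"
    using convergent_imp_Bseq[of ra] ra by (auto simp: convergent_def Bseq_def)
  \<comment> \<open>The remainder left in \<open>key\<close> after division by \<open>k\<close>. It
    vanishes because \<open>rb\<close> converges and \<open>ra + u\<close> is bounded.\<close>
  define h where "h k = (rb k - q) \<bullet> (i k *\<^sub>R \<xi> k) - (i k *\<^sub>R s k) \<bullet> (ra k + u k)" for k
  have "h \<longlonglongrightarrow> (b - q) \<bullet> 0 - 0"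
    unfolding h_def
  proof (intro tendsto_intros rb i\<xi>0 tendsto_inner_bounded[OF is0])
    show "norm (ra k + u k) \<le> Ma + M" for k by (intro norm_triangle_mono Ma M u)
  qed
  then have h0: "h \<longlonglongrightarrow> 0" by simp
  have key: "- h k \<le> dy \<bullet> w k + y k \<bullet> dz" if "k \<ge> 1" for k
  proof -
    \<comment> \<open>Splits \<open>w k\<close> into its linear part \<open>k A dx\<close> and a
      remainder, to be inserted in \<open>y k \<bullet> w k = 0\<close> together with
      \<open>yk\<close>.\<close>
    have wk: "w k = real k *\<^sub>R dz + (A *v \<xi> k - ra k - u k)"
      using p[of k] by (simp add: \<xi>_def ra_def dz_def matrix_vector_mult_diff_distrib matrix_vector_mult_scaleR algebra_simps)
    have yk: "y k = real k *\<^sub>R dy + s k" by (simp add: s_def)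
    have "s k \<bullet> (A *v \<xi> k) = (transpose A *v s k) \<bullet> \<xi> k" by (rule inner_transpose_mult[symmetric])
    \<comment> \<open>Since \<open>P dx = 0\<close> and \<open>A^T dy = 0\<close>, the dual residual
      of \<open>(\<xi> k, s k)\<close> is that of \<open>(x k, y k)\<close>. The possibly quadratic
      growth of \<open>s k \<bullet> (A *v \<xi> k)\<close> thus sits in
      \<open>- \<xi> k \<bullet> (P *v \<xi> k)\<close>, which has a favourable sign.\<close>
    also have "transpose A *v s k = rb k - q - P *v \<xi> k"
      using rel(3,4) by (simp add: s_def rb_def \<xi>_def matrix_vector_mult_diff_distrib matrix_vector_mult_scaleR del: transpose_matrix_vector)
    also have "\<dots> \<bullet> \<xi> k \<le> (rb k - q) \<bullet> \<xi> k"
      using P by (simp add: psd_sym_def inner_diff_left inner_commute[of "P *v \<xi> k"])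
    finally have le: "s k \<bullet> (A *v \<xi> k) \<le> (rb k - q) \<bullet> \<xi> k" .
    have "0 = y k \<bullet> w k" by (simp add: yw)
    also have "\<dots> = real k * (dy \<bullet> w k) + s k \<bullet> w k" by (simp add: yk inner_add_left)
    also have "s k \<bullet> w k = real k * (s k \<bullet> dz) + (s k \<bullet> (A *v \<xi> k) - s k \<bullet> (ra k + u k))"
      by (subst wk) (simp add: inner_add_right inner_diff_right)
    also have "s k \<bullet> dz = y k \<bullet> dz"
    proof -
      have "dy \<bullet> dz = 0" using inner_transpose_mult[of A dy dx] rel(4) by (simp add: dz_def)
      then show ?thesis by (simp add: s_def inner_diff_left)
    qed
    finally have "0 \<le> real k * (dy \<bullet> w k + y k \<bullet> dz) + ((rb k - q) \<bullet> \<xi> k - s k \<bullet> (ra k + u k))"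
      using le by (simp add: algebra_simps)
    then have "0 \<le> i k * (real k * (dy \<bullet> w k + y k \<bullet> dz) + ((rb k - q) \<bullet> \<xi> k - s k \<bullet> (ra k + u k)))"
      using i0 by simp
    also have "\<dots> = (dy \<bullet> w k + y k \<bullet> dz) + h k"
      using that by (simp add: h_def i_def field_simps)
    finally show ?thesis by simp
  qed
  \<comment> \<open>Two nonpositive sequences whose sum is at least \<open>- h k\<close> must both
    tend to 0.\<close>
  have dyw0: "(\<lambda>k. dy \<bullet> w k) \<longlonglongrightarrow> 0"
  proof (rule tendsto_sandwich[of "\<lambda>k. - h k" _ _ "\<lambda>_. 0"])
    show "\<forall>\<^sub>F k in sequentially. - h k \<le> dy \<bullet> w k"
      using eventually_ge_at_top[of 1]
    proof eventually_elim
      case (elim k)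
      then show ?case using key[of k] dzy[of k] by linarith
    qed
  qed (use dyK w tendsto_minus[OF h0] in auto)
  have dzy0: "(\<lambda>k. y k \<bullet> dz) \<longlonglongrightarrow> 0"
  proof (rule tendsto_sandwich[of "\<lambda>k. - h k" _ _ "\<lambda>_. 0"])
    show "\<forall>\<^sub>F k in sequentially. - h k \<le> y k \<bullet> dz"
      using eventually_ge_at_top[of 1]
    proof eventually_elim
      case (elim k)
      then show ?case using key[of k] dyK[OF w, of k] by linarith
    qed
  qed (use dzy tendsto_minus[OF h0] in auto)
  show "dy \<bullet> c \<le> - (dy \<bullet> a)" if "c \<in> C"
  proof -
    obtain v w' where c: "c = v + w'" "v \<in> B" "w' \<in> K" using \<open>c \<in> C\<close> split(1) by blast
    \<comment> \<open>Divide the maximality of \<open>u k\<close> for \<open>y k\<close> over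
      \<open>B\<close> by \<open>k\<close>, then eliminate \<open>dy \<bullet> u k\<close> through
      \<open>dy \<bullet> (A *v x k) = 0\<close>.\<close>
    let ?e = "\<lambda>k. (i k *\<^sub>R s k) \<bullet> (u k - v) - dy \<bullet> ra k - dy \<bullet> w k"
    have "?e \<longlonglongrightarrow> 0 - dy \<bullet> a - 0"
    proof (intro tendsto_intros ra dyw0 tendsto_inner_bounded[OF is0])
      show "norm (u k - v) \<le> M + M" for k
        by (intro order_trans[OF norm_triangle_ineq4] add_mono M u c)
    qed
    moreover have "dy \<bullet> v \<le> ?e k" if "k \<ge> 1" for k
    proof -
      have "dy \<bullet> (A *v x k) = 0" using inner_transpose_mult[of A dy "x k"] rel(4) by simp
      then have dyu: "dy \<bullet> u k = - (dy \<bullet> ra k) - dy \<bullet> w k"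
        by (simp add: ra_def p inner_diff_right inner_add_right)
      have "0 \<le> i k * (y k \<bullet> (u k - v))" using yB[OF c(2)] i0 by (simp add: inner_diff_right)
      also have "\<dots> = (i k *\<^sub>R s k + dy) \<bullet> (u k - v)" unfolding iy[OF that, symmetric] by simp
      finally show ?thesis using dyu by (simp add: inner_add_left inner_diff_right)
    qed
    ultimately have "dy \<bullet> v \<le> 0 - dy \<bullet> a - 0" by (intro LIMSEQ_le_const) blast+
    then show ?thesis using dyK[OF c(3)] by (simp add: c inner_add_right)
  qed
  have "(\<lambda>k. rb k \<bullet> dx - y k \<bullet> dz) \<longlonglongrightarrow> b \<bullet> dx - 0" by (intro tendsto_intros rb dzy0)
  \<comment> \<open>The expression is constant in \<open>k\<close>, since \<open>P dx = 0\<close>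
    removes the term in \<open>x k\<close>.\<close>
  moreover have "rb k \<bullet> dx - y k \<bullet> dz = q \<bullet> dx" for k
  proof -
    have "(P *v x k) \<bullet> dx = 0"
      using rel(3) by (simp add: psd_sym_inner[OF P])
    then show ?thesis
      by (simp add: rb_def inner_add_left dz_def inner_transpose_mult del: transpose_matrix_vector)
  qed
  ultimately show "q \<bullet> dx = b \<bullet> dx" by (simp add: LIMSEQ_const_iff)
qed

section \<open>Projections, normal cones and infeasibility criteria\<close>

lemma closest_point_normal_cone:
  assumes "closed C" "convex C"
  shows "v - closest_point C v \<in> normal_cone C (closest_point C v)"
  using closest_point_dot[OF assms(2,1)] by (simp add: normal_cone_def)

lemma normal_cone_scaleR:
  "0 \<le> c \<Longrightarrow> y \<in> normal_cone C z \<Longrightarrow> c *\<^sub>R y \<in> normal_cone C z"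
  by (auto simp: normal_cone_def mult_nonneg_nonpos)

lemma closest_point_add_normal:
  assumes "closed C" "convex C" "z \<in> C" "y \<in> normal_cone C z"
  shows "closest_point C (z + y) = z"
proof -
  have "dist (z + y) z \<le> dist (z + y) c" if "c \<in> C" for c
  proof -
    have "y \<bullet> (c - z) \<le> 0" using assms(4) that by (auto simp: normal_cone_def)
    moreover have "(norm (y - (c - z)))\<^sup>2 = (norm y)\<^sup>2 - 2 * (y \<bullet> (c - z)) + (norm (c - z))\<^sup>2"
      unfolding power2_norm_eq_inner by (simp add: inner_diff_left inner_diff_right inner_commute)
    ultimately have "(norm y)\<^sup>2 \<le> (norm (y - (c - z)))\<^sup>2"
      using zero_le_power2[of "norm (c - z)"] by linarith
    then have "norm y \<le> norm (y - (c - z))" by (rule power2_le_imp_le) simp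
    then show ?thesis by (simp add: dist_norm algebra_simps)
  qed
  then show ?thesis using closest_point_unique[OF assms(2,1,3), of "z + y"] by simp
qed

text \<open>The translation \<open>b\<close> is absorbed into the bounded factor, leaving a true
  cone as the other one.\<close>

lemma compact_cone_product_decomposition:
  assumes "compact_cone_product C"
  obtains B K where "C = {u + w | u w. u \<in> B \<and> w \<in> K}" "bounded B" "cone K"
proof -
  obtain B b K where BK: "compact B" "cone K" "C = {u + (b + w) | u w. u \<in> B \<and> w \<in> K}"
    using assms unfolding compact_cone_product_def by blast
  show thesis
  proof
    show "C = {u + w | u w. u \<in> (\<lambda>u. b + u) ` B \<and> w \<in> K}"
    proof (intro equalityI subsetI)
      fix c assume "c \<in> C"
      then obtain u w where "c = (b + u) + w" "u \<in> B" "w \<in> K" unfolding BK(3) by (auto simp: algebra_simps)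
      then show "c \<in> {u + w | u w. u \<in> (\<lambda>u. b + u) ` B \<and> w \<in> K}" by blast
    next
      fix c assume "c \<in> {u + w | u w. u \<in> (\<lambda>u. b + u) ` B \<and> w \<in> K}"
      then obtain u w where "c = (b + u) + w" "u \<in> B" "w \<in> K" by blast
      then show "c \<in> C" unfolding BK(3) by (intro CollectI exI[of _ u] exI[of _ w]) (simp add: algebra_simps)
    qed
    show "bounded ((\<lambda>u. b + u) ` B)"
      using BK(1) by (intro bounded_translation compact_imp_bounded)
  qed (rule BK(2))
qed

lemma support_fun_le:
  assumes "\<And>c. c \<in> C \<Longrightarrow> y \<bullet> c \<le> r"
  shows "support_fun C y \<le> ereal r"
  unfolding support_fun_def using assms by (intro SUP_least) simp

lemma primal_infeasibleI:
  assumes "transpose A *v y = 0" "support_fun C y < 0"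
  shows "primal_infeasible A C"
  unfolding primal_infeasible_def
proof
  assume "\<exists>x. A *v x \<in> C"
  then obtain x where "A *v x \<in> C" by blast
  then have "ereal (y \<bullet> (A *v x)) \<le> support_fun C y" unfolding support_fun_def by (rule SUP_upper)
  moreover have "y \<bullet> (A *v x) = 0" using inner_transpose_mult[of A y x] assms(1) by simp
  ultimately show False using assms(2) by (simp add: zero_ereal_def)
qed

text \<open>Pairing a dual feasible point with \<open>d\<close> removes \<open>P x\<close> and
  leaves \<open>- (q \<bullet> d) = y \<bullet> (A d) \<le> 0\<close>.\<close>

lemma dual_infeasibleI:
  assumes "psd_sym P" "P *v d = 0" "A *v d \<in> recession_cone C" "q \<bullet> d < 0"
  shows "dual_infeasible P q A C"
  unfolding dual_infeasible_def
proof
  assume "\<exists>x y. P *v x + transpose A *v y = - q \<and> (\<forall>d\<in>recession_cone C. y \<bullet> d \<le> 0)"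
  then obtain x y where eq: "P *v x + transpose A *v y = - q" and y: "y \<bullet> (A *v d) \<le> 0"
    using assms(3) by blast
  have "(P *v x) \<bullet> d = 0"
    using assms(2) by (simp add: psd_sym_inner[OF assms(1)])
  then have "- (q \<bullet> d) = y \<bullet> (A *v d)"
    using arg_cong[OF eq, of "\<lambda>v. v \<bullet> d"] by (simp only: inner_add_left inner_transpose_mult inner_minus_left)
  with y assms(4) show False by simp
qed

subsection \<open>The ADMM operator\<close>

locale admm =
  fixes P :: "real^'n^'n" and q :: "real^'n" and A :: "real^'n^'m" and C :: "(real^'m) set"
    and \<rho> \<sigma> :: real
  assumes P: "psd_sym P" and C: "C \<noteq> {}" "closed C" "convex C"
    and \<rho>: "\<rho> > 0" and \<sigma>: "\<sigma> > 0"
begin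

text \<open>The second row of the linear system forces \<open>zh = A *v xh\<close>; substituting
  this in the first row leaves an operator in \<open>x\<close> alone, positive definite because
  \<sigma> > 0.\<close>

definition normal_op :: "real^'n \<Rightarrow> real^'n" where
  "normal_op x = P *v x + \<sigma> *\<^sub>R x + \<rho> *\<^sub>R (transpose A *v (A *v x))"

lemma linear_normal_op: "linear normal_op"
  unfolding normal_op_def
  by (intro linear_compose_add linear_compose_scale_right matrix_vector_mul_linear
      linear_compose[OF matrix_vector_mul_linear[of A] matrix_vector_mul_linear[of "transpose A"], unfolded o_def] linear_ident)

lemma inj_normal_op: "inj normal_op"
proof (subst linear_injective_0[OF linear_normal_op], safe)
  fix x assume "normal_op x = 0"
  then have "0 = normal_op x \<bullet> x" by simp
  also have "\<dots> = x \<bullet> (P *v x) + \<sigma> * (x \<bullet> x) + \<rho> * ((A *v x) \<bullet> (A *v x))"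
    by (simp only: normal_op_def inner_add_left inner_scaleR_left inner_transpose_mult inner_commute[of "P *v x"])
  finally have "0 = x \<bullet> (P *v x) + \<sigma> * (x \<bullet> x) + \<rho> * ((A *v x) \<bullet> (A *v x))" .
  moreover have "0 \<le> x \<bullet> (P *v x)" using P by (simp add: psd_sym_def)
  moreover have "0 \<le> \<rho> * ((A *v x) \<bullet> (A *v x))" using \<rho> by simp
  moreover have "0 \<le> \<sigma> * (x \<bullet> x)" using \<sigma> by simp
  ultimately have "\<sigma> * (x \<bullet> x) = 0" by linarith
  then show "x = 0" using \<sigma> by simp
qed

definition solve :: "real^'n \<Rightarrow> real^'n" where "solve = inv normal_op"

lemma normal_op_solve: "normal_op (solve r) = r"
  using linear_injective_imp_surjective[OF linear_normal_op inj_normal_op]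
  by (simp add: solve_def surj_f_inv_f)

lemma solve_unique: "normal_op x = r \<Longrightarrow> x = solve r"
  using inj_normal_op by (simp add: solve_def inv_f_eq)

lemma linear_solve: "linear solve"
  unfolding solve_def by (rule inj_linear_imp_inv_linear[OF linear_normal_op inj_normal_op])

abbreviation proj :: "real^'m \<Rightarrow> real^'m" where "proj \<equiv> closest_point C"

text \<open>The exact solve with \<open>z = proj v\<close> and
  \<open>y = \<rho> (v - proj v)\<close>, for which \<open>z - y / \<rho> = 2 proj v - v\<close>.
  The step thus depends on \<open>x\<close> and \<open>v\<close> only.\<close>

definition xhat :: "real^'n \<Rightarrow> real^'m \<Rightarrow> real^'n" where
  "xhat x v = solve (\<sigma> *\<^sub>R x + \<rho> *\<^sub>R (transpose A *v (2 *\<^sub>R proj v - v)) - q)"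

lemma xhat_equation:
  "P *v xhat x v + \<sigma> *\<^sub>R (xhat x v - x)
    + \<rho> *\<^sub>R (transpose A *v (A *v xhat x v - 2 *\<^sub>R proj v + v)) + q = 0"
proof -
  have "normal_op (xhat x v) = \<sigma> *\<^sub>R x + \<rho> *\<^sub>R (transpose A *v (2 *\<^sub>R proj v - v)) - q"
    by (simp add: xhat_def normal_op_solve)
  then show ?thesis
    by (simp add: normal_op_def matrix_vector_mult_diff_distrib matrix_vector_right_distrib
        algebra_simps del: transpose_matrix_vector)
qed

text \<open>In the coordinates \<open>(sqrt \<sigma> x, sqrt \<rho> v)\<close>, with \<open>v = z + y/\<rho>\<close>, an exact ADMM step is
  \<open>s \<mapsto> s - \<alpha> G s\<close>; the weights turn the metric \<open>\<sigma> |x|^2 + \<rho> |v|^2\<close> into the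
  Euclidean one.\<close>

definition scaled :: "real^'n \<Rightarrow> real^'m \<Rightarrow> (real^'n) \<times> (real^'m)" where
  "scaled x v = (sqrt \<sigma> *\<^sub>R x, sqrt \<rho> *\<^sub>R v)"

definition G :: "(real^'n) \<times> (real^'m) \<Rightarrow> (real^'n) \<times> (real^'m)" where
  "G s = (let x = (1 / sqrt \<sigma>) *\<^sub>R fst s; v = (1 / sqrt \<rho>) *\<^sub>R snd s
          in scaled (x - xhat x v) (proj v - A *v xhat x v))"

lemma G_scaled: "G (scaled x v) = scaled (x - xhat x v) (proj v - A *v xhat x v)"
  using \<rho> \<sigma> by (simp add: G_def scaled_def)

lemma scaled_cases: obtains x v where "s = scaled x v"
  using that[of "(1 / sqrt \<sigma>) *\<^sub>R fst s" "(1 / sqrt \<rho>) *\<^sub>R snd s"] \<rho> \<sigma> by (simp add: scaled_def)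

lemma scaled_diff: "scaled x v - scaled x' v' = scaled (x - x') (v - v')"
  by (simp add: scaled_def scaleR_diff_right)

lemma scaled_scaleR: "scaled (c *\<^sub>R x) (c *\<^sub>R v) = c *\<^sub>R scaled x v"
  by (simp add: scaled_def)

lemma inner_scaled: "scaled x v \<bullet> scaled x' v' = \<sigma> * (x \<bullet> x') + \<rho> * (v \<bullet> v')"
  using \<rho> \<sigma> by (simp add: scaled_def inner_Pair flip: mult.assoc)

lemma tendsto_scaled_iff:
  "((\<lambda>k. scaled (f k) (g k)) \<longlongrightarrow> scaled a b) F \<longleftrightarrow> (f \<longlongrightarrow> a) F \<and> (g \<longlongrightarrow> b) F"
proof
  assume *: "((\<lambda>k. scaled (f k) (g k)) \<longlongrightarrow> scaled a b) F"
  have "((\<lambda>k. (1 / sqrt \<sigma>) *\<^sub>R fst (scaled (f k) (g k))) \<longlongrightarrow> (1 / sqrt \<sigma>) *\<^sub>R fst (scaled a b)) F"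
    "((\<lambda>k. (1 / sqrt \<rho>) *\<^sub>R snd (scaled (f k) (g k))) \<longlongrightarrow> (1 / sqrt \<rho>) *\<^sub>R snd (scaled a b)) F"
    by (intro tendsto_intros *)+
  then show "(f \<longlongrightarrow> a) F \<and> (g \<longlongrightarrow> b) F" using \<rho> \<sigma> by (simp add: scaled_def)
qed (auto simp: scaled_def intro!: tendsto_intros)

text \<open>Two inequalities add up to the claim: firm nonexpansiveness of the projection, weighted
  by \<rho>, and the difference of two instances of \<open>xhat_equation\<close> paired with
  \<open>h\<close>, where semidefiniteness discards the \<open>P\<close> term.\<close>

lemma firmly_nonexpansive_G: "firmly_nonexpansive G"
  unfolding firmly_nonexpansive_def
proof (intro allI)
  fix s t
  obtain x1 v1 where s: "s = scaled x1 v1" by (rule scaled_cases)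
  obtain x2 v2 where t: "t = scaled x2 v2" by (rule scaled_cases)
  define x v z h where "x = x1 - x2" and "v = v1 - v2" and "z = proj v1 - proj v2"
    and "h = xhat x1 v1 - xhat x2 v2"
  have zfirm: "0 \<le> z \<bullet> (v - z)"
  proof -
    have "(v1 - proj v1) \<bullet> (proj v2 - proj v1) \<le> 0" "(v2 - proj v2) \<bullet> (proj v1 - proj v2) \<le> 0"
      by (intro closest_point_dot C closest_point_in_set)+
    then show ?thesis
      by (simp add: z_def v_def inner_diff_left inner_diff_right inner_commute)
  qed
  have "P *v h + \<sigma> *\<^sub>R (h - x) + \<rho> *\<^sub>R (transpose A *v (A *v h - 2 *\<^sub>R z + v)) = 0"
  proof -
    have "P *v h + \<sigma> *\<^sub>R (h - x) + \<rho> *\<^sub>R (transpose A *v (A *v h - 2 *\<^sub>R z + v))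
      = (P *v xhat x1 v1 + \<sigma> *\<^sub>R (xhat x1 v1 - x1)
          + \<rho> *\<^sub>R (transpose A *v (A *v xhat x1 v1 - 2 *\<^sub>R proj v1 + v1)) + q)
      - (P *v xhat x2 v2 + \<sigma> *\<^sub>R (xhat x2 v2 - x2)
          + \<rho> *\<^sub>R (transpose A *v (A *v xhat x2 v2 - 2 *\<^sub>R proj v2 + v2)) + q)"
      by (simp add: h_def x_def z_def v_def matrix_vector_mult_diff_distrib matrix_vector_right_distrib
          algebra_simps del: transpose_matrix_vector)
    then show ?thesis by (simp only: xhat_equation diff_self)
  qed
  from arg_cong[OF this, of "\<lambda>w. w \<bullet> h"]
  have "h \<bullet> (P *v h) + \<sigma> * ((h - x) \<bullet> h) + \<rho> * ((A *v h - 2 *\<^sub>R z + v) \<bullet> (A *v h)) = 0"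
    by (simp only: inner_add_left inner_scaleR_left inner_transpose_mult inner_zero_left inner_commute[of "P *v h"])
  moreover have "0 \<le> h \<bullet> (P *v h)" using P by (simp add: psd_sym_def)
  ultimately have lin: "\<sigma> * ((h - x) \<bullet> h) + \<rho> * ((A *v h - 2 *\<^sub>R z + v) \<bullet> (A *v h)) \<le> 0" by linarith
  have "0 \<le> \<rho> * (z \<bullet> (v - z))" using zfirm \<rho> by simp
  with lin have "\<sigma> * ((x - h) \<bullet> (x - h)) + \<rho> * ((z - A *v h) \<bullet> (z - A *v h))
      \<le> \<sigma> * ((x - h) \<bullet> x) + \<rho> * ((z - A *v h) \<bullet> v)"
    by (simp add: inner_diff_left inner_diff_right inner_add_left inner_commute algebra_simps)
  moreover have "G s - G t = scaled (x - h) (z - A *v h)"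
    by (simp add: s t G_scaled scaled_diff x_def z_def h_def matrix_vector_mult_diff_distrib algebra_simps)
  moreover have "s - t = scaled x v" by (simp add: s t scaled_diff x_def v_def)
  ultimately show "(norm (G s - G t))\<^sup>2 \<le> (G s - G t) \<bullet> (s - t)"
    by (simp only: power2_norm_eq_inner inner_scaled)
qed

text \<open>Since \<open>y\<close> is normal at \<open>z\<close>, projecting
  \<open>z + y / \<rho>\<close> returns \<open>z\<close>; stationarity then says that
  \<open>x\<close> solves the linear system built from its own data.\<close>

lemma kkt_point_imp_G_zero:
  assumes "kkt_point P q A C x z y"
  shows "G (scaled x (z + (1 / \<rho>) *\<^sub>R y)) = 0"
proof -
  let ?v = "z + (1 / \<rho>) *\<^sub>R y"
  have kkt: "P *v x + q + transpose A *v y = 0" "A *v x = z" "z \<in> C" "y \<in> normal_cone C z"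
    using assms by (auto simp: kkt_point_def)
  have proj: "proj ?v = z"
    by (intro closest_point_add_normal normal_cone_scaleR C kkt) (use \<rho> in simp)
  have "P *v x = - q - transpose A *v y" using kkt(1) by (simp add: algebra_simps eq_neg_iff_add_eq_0)
  moreover have "2 *\<^sub>R z - ?v = z - (1 / \<rho>) *\<^sub>R y" by (simp add: scaleR_2)
  ultimately have "normal_op x = \<sigma> *\<^sub>R x + \<rho> *\<^sub>R (transpose A *v (2 *\<^sub>R z - ?v)) - q"
    using \<rho> by (simp add: normal_op_def kkt(2) matrix_vector_mult_diff_distrib matrix_vector_right_distrib
        matrix_vector_mult_scaleR algebra_simps del: transpose_matrix_vector)
  then have "xhat x ?v = x" unfolding xhat_def proj by (rule solve_unique[symmetric])
  then have "G (scaled x ?v) = scaled 0 0" by (simp add: G_scaled proj kkt(2))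
  then show ?thesis by (simp add: scaled_def zero_prod_def)
qed

text \<open>The pair \<open>(z, y)\<close> is recovered from \<open>v\<close> by its projection and
  the rescaled projection residual.\<close>

lemma G_zero_imp_kkt_point:
  assumes "G (scaled x v) = 0"
  shows "kkt_point P q A C x (proj v) (\<rho> *\<^sub>R (v - proj v))"
proof -
  have "scaled (x - xhat x v) (proj v - A *v xhat x v) = 0" using assms by (simp add: G_scaled)
  then have x: "xhat x v = x" and Ax: "A *v x = proj v"
    using \<rho> \<sigma> by (auto simp: scaled_def zero_prod_def)
  have "P *v x + q + transpose A *v (\<rho> *\<^sub>R (v - proj v)) = 0"
  proof -
    have "A *v xhat x v - 2 *\<^sub>R proj v + v = v - proj v" by (simp add: x Ax scaleR_2)
    from xhat_equation[of x v, unfolded this] show ?thesis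
      by (simp add: x matrix_vector_mult_scaleR add_ac del: transpose_matrix_vector)
  qed
  moreover have "proj v \<in> C" by (intro closest_point_in_set C)
  moreover have "\<rho> *\<^sub>R (v - proj v) \<in> normal_cone C (proj v)"
    by (intro normal_cone_scaleR closest_point_normal_cone C) (use \<rho> in simp)
  ultimately show ?thesis by (simp add: kkt_point_def Ax)
qed

end

subsection \<open>Approximate ADMM iterates\<close>

locale admm_run = admm P q A C \<rho> \<sigma>
  for P :: "real^'n^'n" and q :: "real^'n" and A :: "real^'n^'m" and C :: "(real^'m) set"
    and \<rho> \<sigma> :: real +
  fixes \<alpha> :: real and \<mu> \<nu> :: "nat \<Rightarrow> real"
    and x xt :: "nat \<Rightarrow> real^'n" and z zt y :: "nat \<Rightarrow> real^'m"
  assumes \<alpha>: "0 < \<alpha>" "\<alpha> < 2"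
    and \<mu>: "summable \<mu>" and \<nu>: "summable \<nu>"
    and step1: "\<And>k. \<exists>xh zh.
        P *v xh + \<sigma> *\<^sub>R xh + \<rho> *\<^sub>R (transpose A *v zh)
          = \<sigma> *\<^sub>R x k + \<rho> *\<^sub>R (transpose A *v (z k - (1/\<rho>) *\<^sub>R y k)) - q
      \<and> \<rho> *\<^sub>R (A *v xh) - \<rho> *\<^sub>R zh = 0
      \<and> norm (xt (Suc k) - xh, zt (Suc k) - zh) \<le> \<mu> k"
    and step2: "\<And>k. x (Suc k) = \<alpha> *\<^sub>R xt (Suc k) + (1 - \<alpha>) *\<^sub>R x k"
    and step3: "\<And>k. norm (z (Suc k) - closest_point C
          (\<alpha> *\<^sub>R zt (Suc k) + (1 - \<alpha>) *\<^sub>R z k + (1/\<rho>) *\<^sub>R y k)) \<le> \<nu> k"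
    and step4: "\<And>k. y (Suc k) = y k + \<rho> *\<^sub>R (\<alpha> *\<^sub>R zt (Suc k) + (1 - \<alpha>) *\<^sub>R z k - z (Suc k))"
begin

definition v :: "nat \<Rightarrow> real^'m" where "v k = z k + (1/\<rho>) *\<^sub>R y k"

definition p :: "nat \<Rightarrow> real^'m" where "p k = proj (v k)"

abbreviation h :: "nat \<Rightarrow> real^'n" where "h k \<equiv> xhat (x k) (v k)"

text \<open>The dual update cancels \<open>z (Suc k)\<close>, so \<open>v (Suc k)\<close> is exactly
  the vector projected in step 3, free of the projection error.\<close>

lemma v_Suc: "v (Suc k) = \<alpha> *\<^sub>R zt (Suc k) + (1 - \<alpha>) *\<^sub>R z k + (1/\<rho>) *\<^sub>R y k"
  using \<rho> by (simp add: v_def step4 scaleR_add_right)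

lemma v_Suc': "v (Suc k) = v k + \<alpha> *\<^sub>R (zt (Suc k) - z k)"
  unfolding v_Suc by (simp add: v_def algebra_simps)

lemma x_Suc: "x (Suc k) = x k + \<alpha> *\<^sub>R (xt (Suc k) - x k)"
  by (simp add: step2 algebra_simps)

lemma y_eq: "y k = \<rho> *\<^sub>R (v k - z k)"
  using \<rho> by (simp add: v_def)

text \<open>Step 3 bounds the error from index 1 on; the arbitrary initial term does not affect
  summability.\<close>

lemma z_error_summable: "summable (\<lambda>k. norm (z k - p k))"
proof -
  have "summable (\<lambda>k. norm (z (Suc k) - p (Suc k)))"
    by (rule summable_comparison_test'[OF \<nu>, of 0]) (use step3 in \<open>simp add: p_def v_Suc\<close>)
  then show ?thesis by (rule iffD1[OF summable_Suc_iff])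
qed

lemma z_error_tendsto: "(\<lambda>k. z k - p k) \<longlonglongrightarrow> 0"
  using summable_LIMSEQ_zero[OF z_error_summable] by (simp add: tendsto_norm_zero_iff)

text \<open>Two error sources: the tolerance \<open>\<mu> k\<close>, and \<open>z k\<close> standing
  where \<open>h k\<close> uses \<open>p k\<close>. The latter enters through bounded linear maps,
  whose bounds \<open>L\<close> and \<open>K * L\<close> determine \<open>c\<close>.\<close>

lemma tilde_error:
  "\<exists>c\<ge>0. \<forall>k. norm (xt (Suc k) - h k) \<le> \<mu> k + c * norm (z k - p k)
    \<and> norm (zt (Suc k) - A *v h k) \<le> \<mu> k + c * norm (z k - p k)"
proof -
  let ?f = "\<lambda>e. solve (\<rho> *\<^sub>R (transpose A *v (2 *\<^sub>R e)))"
  have "linear ?f"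
  proof -
    have "linear (\<lambda>e. \<rho> *\<^sub>R (transpose A *v (2 *\<^sub>R e)))"
      by (rule linearI) (simp_all add: matrix_vector_right_distrib matrix_vector_mult_scaleR
          algebra_simps del: transpose_matrix_vector)
    from linear_compose[OF this linear_solve] show ?thesis by (simp add: o_def)
  qed
  then obtain L where L: "L > 0" "\<And>e. norm (?f e) \<le> L * norm e" using linear_bounded_pos by blast
  obtain K where K: "K > 0" "\<And>u. norm (A *v u) \<le> K * norm u"
    using linear_bounded_pos[OF matrix_vector_mul_linear[of A]] by blast
  have err: "norm (xt (Suc k) - h k) \<le> \<mu> k + L * norm (z k - p k)
    \<and> norm (zt (Suc k) - A *v h k) \<le> \<mu> k + (K * L) * norm (z k - p k)" for k
  proof -
    obtain xh zh where eq: "P *v xh + \<sigma> *\<^sub>R xh + \<rho> *\<^sub>R (transpose A *v zh)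
          = \<sigma> *\<^sub>R x k + \<rho> *\<^sub>R (transpose A *v (z k - (1/\<rho>) *\<^sub>R y k)) - q"
      and zh: "\<rho> *\<^sub>R (A *v xh) - \<rho> *\<^sub>R zh = 0"
      and n: "norm (xt (Suc k) - xh, zt (Suc k) - zh) \<le> \<mu> k"
      using step1[of k] by blast
    have zh': "zh = A *v xh" using zh \<rho> by simp
    have "normal_op xh = \<sigma> *\<^sub>R x k + \<rho> *\<^sub>R (transpose A *v (z k - (1/\<rho>) *\<^sub>R y k)) - q"
      using eq by (simp add: normal_op_def zh')
    then have xh: "xh = solve (\<sigma> *\<^sub>R x k + \<rho> *\<^sub>R (transpose A *v (z k - (1/\<rho>) *\<^sub>R y k)) - q)"
      by (rule solve_unique)
    \<comment> \<open>Both solves share the terms in \<open>x k\<close> and \<open>q\<close>; by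
      linearity their difference depends only on \<open>2 (z k - p k)\<close>.\<close>
    have "z k - (1/\<rho>) *\<^sub>R y k - (2 *\<^sub>R p k - v k) = 2 *\<^sub>R (z k - p k)"
      by (simp add: v_def scaleR_2)
    then have "xh - h k = ?f (z k - p k)"
      unfolding xh xhat_def p_def[symmetric] linear_diff[OF linear_solve, symmetric]
      by (simp only: add_diff_cancel_left diff_diff_eq2 diff_add_cancel flip: matrix_vector_mult_diff_distrib scaleR_diff_right)
    then have d: "norm (xh - h k) \<le> L * norm (z k - p k)" using L(2) by simp
    have "norm (xt (Suc k) - xh) \<le> \<mu> k" "norm (zt (Suc k) - zh) \<le> \<mu> k"
      using n by (auto intro: order_trans[OF norm_fst_le] order_trans[OF norm_snd_le])
    moreover have "norm (zh - A *v h k) \<le> (K * L) * norm (z k - p k)"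
    proof -
      have "norm (zh - A *v h k) \<le> K * norm (xh - h k)"
        using K(2)[of "xh - h k"] by (simp add: zh' matrix_vector_mult_diff_distrib)
      also have "\<dots> \<le> K * (L * norm (z k - p k))" using d K(1) by simp
      finally show ?thesis by simp
    qed
    moreover have "norm (xt (Suc k) - h k) \<le> norm (xt (Suc k) - xh) + norm (xh - h k)"
      using norm_triangle_ineq[of "xt (Suc k) - xh" "xh - h k"] by simp
    moreover have "norm (zt (Suc k) - A *v h k) \<le> norm (zt (Suc k) - zh) + norm (zh - A *v h k)"
      using norm_triangle_ineq[of "zt (Suc k) - zh" "zh - A *v h k"] by simp
    ultimately show ?thesis using d by linarith
  qed
  show ?thesis
  proof (intro exI[of _ "max L (K * L)"] conjI allI)
    show "max L (K * L) \<ge> 0" using L by simp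
    fix k
    have "L * norm (z k - p k) \<le> max L (K * L) * norm (z k - p k)"
      "K * L * norm (z k - p k) \<le> max L (K * L) * norm (z k - p k)"
      by (auto intro: mult_right_mono)
    then show "norm (xt (Suc k) - h k) \<le> \<mu> k + max L (K * L) * norm (z k - p k)"
      "norm (zt (Suc k) - A *v h k) \<le> \<mu> k + max L (K * L) * norm (z k - p k)"
      using err[of k] by linarith+
  qed
qed

definition s :: "nat \<Rightarrow> (real^'n) \<times> (real^'m)" where "s k = scaled (x k) (v k)"

text \<open>The actual step in \<open>v\<close> is \<open>\<alpha> (zt - z)\<close>, the exact one
  \<open>\<alpha> (A h - p)\<close>, so the defect consists of the errors from
  \<open>tilde_error\<close> and \<open>z k - p k\<close>.\<close>

lemma step_error_summable: "summable (\<lambda>k. norm (s (Suc k) - (s k - \<alpha> *\<^sub>R G (s k))))"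
proof -
  obtain c where c: "c \<ge> 0"
    "\<And>k. norm (xt (Suc k) - h k) \<le> \<mu> k + c * norm (z k - p k)"
    "\<And>k. norm (zt (Suc k) - A *v h k) \<le> \<mu> k + c * norm (z k - p k)"
    using tilde_error by blast
  define e where "e k = \<mu> k + c * norm (z k - p k)" for k
  have e: "summable e" unfolding e_def
    by (intro summable_add \<mu> summable_mult z_error_summable)
  let ?b = "\<lambda>k. \<alpha> * (sqrt \<sigma> * e k + sqrt \<rho> * (e k + norm (z k - p k)))"
  have b: "summable ?b" by (intro summable_add summable_mult e z_error_summable)
  have "norm (s (Suc k) - (s k - \<alpha> *\<^sub>R G (s k))) \<le> ?b k" for k
  proof -
    have "s (Suc k) - (s k - \<alpha> *\<^sub>R G (s k))
        = scaled (\<alpha> *\<^sub>R (xt (Suc k) - h k)) (\<alpha> *\<^sub>R ((zt (Suc k) - A *v h k) - (z k - p k)))"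
    proof -
      have "x (Suc k) - (x k - \<alpha> *\<^sub>R (x k - h k)) = \<alpha> *\<^sub>R (xt (Suc k) - h k)"
        by (simp add: x_Suc scaleR_diff_right)
      moreover have "v (Suc k) - (v k - \<alpha> *\<^sub>R (p k - A *v h k))
          = \<alpha> *\<^sub>R ((zt (Suc k) - A *v h k) - (z k - p k))"
        by (simp add: v_Suc' scaleR_diff_right)
      ultimately show ?thesis
        by (simp only: s_def G_scaled p_def[symmetric] scaled_scaleR[symmetric] scaled_diff)
    qed
    also have "\<dots> = \<alpha> *\<^sub>R scaled (xt (Suc k) - h k) ((zt (Suc k) - A *v h k) - (z k - p k))"
      by (rule scaled_scaleR)
    also have "norm \<dots> = \<alpha> * norm (scaled (xt (Suc k) - h k) ((zt (Suc k) - A *v h k) - (z k - p k)))"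
      using \<alpha> by simp
    also have "\<dots> \<le> \<alpha> * (sqrt \<sigma> * norm (xt (Suc k) - h k)
        + sqrt \<rho> * norm ((zt (Suc k) - A *v h k) - (z k - p k)))"
      unfolding scaled_def using \<alpha> \<rho> \<sigma> norm_Pair_le[of "sqrt \<sigma> *\<^sub>R (xt (Suc k) - h k)"
          "sqrt \<rho> *\<^sub>R ((zt (Suc k) - A *v h k) - (z k - p k))"]
      by (intro mult_left_mono) auto
    also have "\<dots> \<le> \<alpha> * (sqrt \<sigma> * norm (xt (Suc k) - h k)
        + sqrt \<rho> * (norm (zt (Suc k) - A *v h k) + norm (z k - p k)))"
      using \<alpha> \<rho> \<sigma> by (intro mult_left_mono add_left_mono norm_triangle_ineq4) auto
    also have "\<dots> \<le> ?b k"
      using \<alpha> \<rho> \<sigma> c(2,3)[of k] by (intro mult_left_mono add_mono) (auto simp: e_def)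
    finally show ?thesis .
  qed
  then show ?thesis by (intro summable_norm_comparison_test[OF _ b] exI[of _ 0] allI impI)
qed

lemma converges_to_kkt_point:
  assumes "kkt_point P q A C x0 z0 y0"
  shows "\<exists>xb zb yb. kkt_point P q A C xb zb yb \<and> x \<longlonglongrightarrow> xb \<and> z \<longlonglongrightarrow> zb \<and> y \<longlonglongrightarrow> yb"
proof -
  \<comment> \<open>\<open>order_refl\<close> takes the norm of the defect itself as the error
    sequence.\<close>
  obtain t where t: "G t = 0" "s \<longlonglongrightarrow> t"
    using inexact_krasnoselskii_mann[OF firmly_nonexpansive_G \<alpha> order_refl step_error_summable
        kkt_point_imp_G_zero[OF assms]] .
  obtain xb vb where tb: "t = scaled xb vb" by (rule scaled_cases)
  have "(\<lambda>k. scaled (x k) (v k)) \<longlonglongrightarrow> scaled xb vb" using t(2) unfolding tb s_def[abs_def] .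
  then have x: "x \<longlonglongrightarrow> xb" and v: "v \<longlonglongrightarrow> vb" unfolding tendsto_scaled_iff by auto
  have "p \<longlonglongrightarrow> proj vb"
    unfolding p_def[abs_def]
    by (rule isCont_tendsto_compose[OF continuous_at_closest_point v]) (rule C)+
  from tendsto_add[OF z_error_tendsto this] have z: "z \<longlonglongrightarrow> proj vb" by simp
  have "(\<lambda>k. \<rho> *\<^sub>R (v k - z k)) \<longlonglongrightarrow> \<rho> *\<^sub>R (vb - proj vb)" by (intro tendsto_intros v z)
  then have y: "y \<longlonglongrightarrow> \<rho> *\<^sub>R (vb - proj vb)" by (simp flip: y_eq)
  have "kkt_point P q A C xb (proj vb) (\<rho> *\<^sub>R (vb - proj vb))"
    using G_zero_imp_kkt_point t(1) tb by simp
  with x y z show ?thesis by blast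
qed

text \<open>Convergence of \<open>G (s k)\<close> yields the displacements and both residual limits
  at once. The residual limits are then expressed through \<open>dx\<close> and \<open>dy\<close>,
  so the pairings in the certificates become squared norms with a sign.\<close>

lemma displacement_limits:
  assumes "compact_cone_product C"
  shows "\<exists>dx dy. (\<lambda>k. x (Suc k) - x k) \<longlonglongrightarrow> dx \<and> (\<lambda>k. y (Suc k) - y k) \<longlonglongrightarrow> dy
    \<and> (dy \<noteq> 0 \<longrightarrow> transpose A *v dy = 0 \<and> support_fun C dy < 0)
    \<and> (dx \<noteq> 0 \<longrightarrow> P *v dx = 0 \<and> A *v dx \<in> recession_cone C \<and> q \<bullet> dx < 0)"
proof -
  obtain g where g: "(\<lambda>k. G (s k)) \<longlonglongrightarrow> g"
    using inexact_displacement_tendsto[OF firmly_nonexpansive_G \<alpha> order_refl step_error_summable] .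
  obtain gx gv where gxv: "g = scaled gx gv" by (rule scaled_cases)
  have "(\<lambda>k. scaled (x k - h k) (p k - A *v h k)) \<longlonglongrightarrow> scaled gx gv"
    using g unfolding gxv s_def G_scaled p_def .
  then have gx: "(\<lambda>k. x k - h k) \<longlonglongrightarrow> gx" and gv: "(\<lambda>k. p k - A *v h k) \<longlonglongrightarrow> gv"
    unfolding tendsto_scaled_iff by auto
  define dx dv where "dx = - \<alpha> *\<^sub>R gx" and "dv = - \<alpha> *\<^sub>R gv"
  have "(\<lambda>k. (s (Suc k) - (s k - \<alpha> *\<^sub>R G (s k))) - \<alpha> *\<^sub>R G (s k)) \<longlonglongrightarrow> 0 - \<alpha> *\<^sub>R g"
    using summable_LIMSEQ_zero[OF step_error_summable]
    by (intro tendsto_intros g) (simp add: tendsto_norm_zero_iff)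
  moreover have "(s (Suc k) - (s k - \<alpha> *\<^sub>R G (s k))) - \<alpha> *\<^sub>R G (s k)
      = scaled (x (Suc k) - x k) (v (Suc k) - v k)" for k
    by (simp add: s_def scaled_diff)
  moreover have "0 - \<alpha> *\<^sub>R g = scaled dx dv"
    by (simp add: gxv dx_def dv_def scaled_def)
  ultimately have "(\<lambda>k. scaled (x (Suc k) - x k) (v (Suc k) - v k)) \<longlonglongrightarrow> scaled dx dv"
    by (simp only:)
  then have dx: "(\<lambda>k. x (Suc k) - x k) \<longlonglongrightarrow> dx" and dv: "(\<lambda>k. v (Suc k) - v k) \<longlonglongrightarrow> dv"
    unfolding tendsto_scaled_iff by auto
  have primal: "(\<lambda>k. A *v x k - p k) \<longlonglongrightarrow> A *v gx - gv"
  proof -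
    have "(\<lambda>k. A *v (x k - h k) - (p k - A *v h k)) \<longlonglongrightarrow> A *v gx - gv"
      by (intro tendsto_intros tendsto_matrix_vector_mult gx gv)
    then show ?thesis by (simp add: matrix_vector_mult_diff_distrib)
  qed
  \<comment> \<open>The multiplier belonging to the exact projection, hence normal at
    \<open>p k\<close>; it differs from \<open>y k\<close> by \<open>\<rho> (z k - p k)\<close>,
    which tends to 0.\<close>
  define yh where "yh k = \<rho> *\<^sub>R (v k - p k)" for k
  let ?b = "P *v gx + \<sigma> *\<^sub>R gx + \<rho> *\<^sub>R (transpose A *v gv)"
  have dual: "(\<lambda>k. P *v x k + q + transpose A *v yh k) \<longlonglongrightarrow> ?b"
  proof -
    have "(\<lambda>k. P *v (x k - h k) + \<sigma> *\<^sub>R (x k - h k) + \<rho> *\<^sub>R (transpose A *v (p k - A *v h k))) \<longlonglongrightarrow> ?b"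
      by (intro tendsto_intros tendsto_matrix_vector_mult gx gv)
    \<comment> \<open>The two sides differ by the left side of \<open>xhat_equation\<close>, which
      is zero.\<close>
    moreover have "P *v (x k - h k) + \<sigma> *\<^sub>R (x k - h k) + \<rho> *\<^sub>R (transpose A *v (p k - A *v h k))
        = P *v x k + q + transpose A *v yh k" for k
    proof -
      have "P *v (x k - h k) + \<sigma> *\<^sub>R (x k - h k) + \<rho> *\<^sub>R (transpose A *v (p k - A *v h k))
        = (P *v x k + q + transpose A *v yh k)
          - (P *v h k + \<sigma> *\<^sub>R (h k - x k) + \<rho> *\<^sub>R (transpose A *v (A *v h k - 2 *\<^sub>R p k + v k)) + q)"
        by (simp only: yh_def scaleR_2 matrix_vector_mult_diff_distrib matrix_vector_right_distrib
            matrix_vector_mult_scaleR scaleR_add_right scaleR_diff_right) simp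
      then show ?thesis unfolding xhat_equation[of "x k" "v k", folded p_def] by simp
    qed
    ultimately show ?thesis by simp
  qed
  have dp: "(\<lambda>k. p (Suc k) - p k) \<longlonglongrightarrow> A *v dx"
  proof -
    have "(\<lambda>k. A *v (x (Suc k) - x k) - ((A *v x (Suc k) - p (Suc k)) - (A *v x k - p k)))
        \<longlonglongrightarrow> A *v dx - ((A *v gx - gv) - (A *v gx - gv))"
      by (intro tendsto_intros tendsto_matrix_vector_mult dx primal LIMSEQ_Suc[OF primal])
    then show ?thesis by (simp add: matrix_vector_mult_diff_distrib algebra_simps)
  qed
  define dy where "dy = \<rho> *\<^sub>R (dv - A *v dx)"
  have dyh: "(\<lambda>k. yh (Suc k) - yh k) \<longlonglongrightarrow> dy"
  proof -
    have "(\<lambda>k. \<rho> *\<^sub>R ((v (Suc k) - v k) - (p (Suc k) - p k))) \<longlonglongrightarrow> dy"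
      unfolding dy_def by (intro tendsto_intros dv dp)
    then show ?thesis by (simp add: yh_def algebra_simps)
  qed
  have dy: "(\<lambda>k. y (Suc k) - y k) \<longlonglongrightarrow> dy"
  proof -
    have "(\<lambda>k. (yh (Suc k) - yh k) - \<rho> *\<^sub>R ((z (Suc k) - p (Suc k)) - (z k - p k))) \<longlonglongrightarrow> dy - \<rho> *\<^sub>R (0 - 0)"
      by (intro tendsto_intros dyh z_error_tendsto LIMSEQ_Suc[OF z_error_tendsto])
    then show ?thesis by (simp add: yh_def y_eq algebra_simps)
  qed
  have pC: "p k \<in> C" for k unfolding p_def by (intro closest_point_in_set C)
  have yN: "yh k \<in> normal_cone C (p k)" for k
    unfolding yh_def p_def by (intro normal_cone_scaleR closest_point_normal_cone C) (use \<rho> in simp)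
  obtain B K where BK: "C = {u + w | u w. u \<in> B \<and> w \<in> K}" "bounded B" "cone K"
    using compact_cone_product_decomposition[OF assms] .
  note rel = displacement_relations[OF P C(2,3) pC yN dx dyh primal dual]
  note cert = displacement_certificate_bounds[OF P C(2,3) BK pC yN dx dyh primal dual]
  have gx': "gx = - (1 / \<alpha>) *\<^sub>R dx" and gv': "gv = - (1 / \<alpha>) *\<^sub>R dv"
    using \<alpha> by (simp_all add: dx_def dv_def)
  have dv': "dv = A *v dx + (1 / \<rho>) *\<^sub>R dy" using \<rho> by (simp add: dy_def)
  have "support_fun C dy < 0" if "dy \<noteq> 0"
  proof -
    \<comment> \<open>The primal residual limit is \<open>dy / (\<alpha> \<rho>)\<close>, so its
      pairing with \<open>dy\<close> is strictly positive.\<close>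
    have "A *v gx - gv = (1 / \<alpha>) *\<^sub>R (dv - A *v dx)"
      unfolding gx' gv' by (simp only: matrix_vector_mult_scaleR scaleR_diff_right) simp
    also have "\<dots> = (1 / (\<alpha> * \<rho>)) *\<^sub>R dy" by (simp add: dv')
    finally have "dy \<bullet> (A *v gx - gv) = (1 / (\<alpha> * \<rho>)) * (dy \<bullet> dy)" by simp
    also have "\<dots> > 0" using that \<alpha> \<rho> by simp
    finally have "ereal (- (dy \<bullet> (A *v gx - gv))) < 0" by simp
    moreover have "support_fun C dy \<le> ereal (- (dy \<bullet> (A *v gx - gv)))"
      by (intro support_fun_le cert(1))
    ultimately show ?thesis by (rule le_less_trans[rotated])
  qed
  moreover have "q \<bullet> dx < 0" if "dx \<noteq> 0"
  proof -
    have "transpose A *v dv = transpose A *v (A *v dx)"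
      using rel(4) by (simp add: dv' matrix_vector_right_distrib matrix_vector_mult_scaleR del: transpose_matrix_vector)
    then have "transpose A *v gv = - (1 / \<alpha>) *\<^sub>R (transpose A *v (A *v dx))"
      unfolding gv' by (simp only: matrix_vector_mult_scaleR)
    \<comment> \<open>With \<open>P dx = 0\<close> and \<open>A^T dy = 0\<close>, the dual residual
      limit is a negative multiple of a positive definite operator applied to
      \<open>dx\<close>.\<close>
    then have "?b = - (1 / \<alpha>) *\<^sub>R (\<sigma> *\<^sub>R dx + \<rho> *\<^sub>R (transpose A *v (A *v dx)))"
      unfolding gx' using rel(3)
      by (simp only: matrix_vector_mult_scaleR) (simp add: algebra_simps del: transpose_matrix_vector)
    then have "q \<bullet> dx = - (1 / \<alpha>) * (\<sigma> * (dx \<bullet> dx) + \<rho> * ((A *v dx) \<bullet> (A *v dx)))"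
      unfolding cert(2) by (simp only: inner_scaleR_left inner_add_left inner_transpose_mult)
    moreover have "\<sigma> * (dx \<bullet> dx) > 0" "\<rho> * ((A *v dx) \<bullet> (A *v dx)) \<ge> 0" using that \<rho> \<sigma> by simp_all
    ultimately show ?thesis using \<alpha> by (simp add: add_pos_nonneg)
  qed
  ultimately show ?thesis using dx dy rel(2-4) by blast
qed

end

theorem theorem1:
  fixes P :: "real^'n^'n" and q :: "real^'n" and A :: "real^'n^'m"
    and C :: "(real^'m) set"
    and \<rho> \<sigma> \<alpha> :: real and \<mu> \<nu> :: "nat \<Rightarrow> real"
    and x xt :: "nat \<Rightarrow> real^'n" and z zt y :: "nat \<Rightarrow> real^'m"
  assumes P: "psd_sym P"
    and C_ne: "C \<noteq> {}" and C_closed: "closed C" and C_convex: "convex C"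
    and C_prod: "compact_cone_product C"
    and rho: "\<rho> > 0" and sigma: "\<sigma> > 0" and alpha: "0 < \<alpha>" "\<alpha> < 2"
    and mu: "\<forall>k. 0 \<le> \<mu> k" "summable \<mu>"
    and nu: "\<forall>k. 0 \<le> \<nu> k" "summable \<nu>"
    and step1: "\<forall>k. \<exists>xh zh.
        P *v xh + \<sigma> *\<^sub>R xh + \<rho> *\<^sub>R (transpose A *v zh)
          = \<sigma> *\<^sub>R x k + \<rho> *\<^sub>R (transpose A *v (z k - (1/\<rho>) *\<^sub>R y k)) - q
      \<and> \<rho> *\<^sub>R (A *v xh) - \<rho> *\<^sub>R zh = 0
      \<and> norm (xt (Suc k) - xh, zt (Suc k) - zh) \<le> \<mu> k"
    and step2: "\<forall>k. x (Suc k) = \<alpha> *\<^sub>R xt (Suc k) + (1 - \<alpha>) *\<^sub>R x k"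
    and step3: "\<forall>k. norm (z (Suc k) - closest_point C
          (\<alpha> *\<^sub>R zt (Suc k) + (1 - \<alpha>) *\<^sub>R z k + (1/\<rho>) *\<^sub>R y k)) \<le> \<nu> k"
    and step4: "\<forall>k. y (Suc k) = y k + \<rho> *\<^sub>R (\<alpha> *\<^sub>R zt (Suc k) + (1 - \<alpha>) *\<^sub>R z k - z (Suc k))"
  shows "((\<exists>xb zb yb. kkt_point P q A C xb zb yb) \<longrightarrow>
            (\<exists>xb zb yb. kkt_point P q A C xb zb yb
               \<and> x \<longlonglongrightarrow> xb \<and> z \<longlonglongrightarrow> zb \<and> y \<longlonglongrightarrow> yb))
       \<and> (\<exists>dx dy. (\<lambda>k. x (Suc k) - x k) \<longlonglongrightarrow> dx \<and> (\<lambda>k. y (Suc k) - y k) \<longlonglongrightarrow> dy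
            \<and> (dy \<noteq> 0 \<longrightarrow> primal_infeasible A C \<and> transpose A *v dy = 0
                  \<and> support_fun C dy < 0)
            \<and> (dx \<noteq> 0 \<longrightarrow> dual_infeasible P q A C \<and> P *v dx = 0
                  \<and> A *v dx \<in> recession_cone C \<and> q \<bullet> dx < 0)
            \<and> (dx \<noteq> 0 \<and> dy \<noteq> 0 \<longrightarrow>
                  primal_infeasible A C \<and> dual_infeasible P q A C
                  \<and> transpose A *v dy = 0 \<and> support_fun C dy < 0
                  \<and> P *v dx = 0 \<and> A *v dx \<in> recession_cone C \<and> q \<bullet> dx < 0))"
proof -
  interpret admm_run P q A C \<rho> \<sigma> \<alpha> \<mu> \<nu> x xt z zt y
    by unfold_locales (use assms in auto)
  obtain dx dy where lim: "(\<lambda>k. x (Suc k) - x k) \<longlonglongrightarrow> dx" "(\<lambda>k. y (Suc k) - y k) \<longlonglongrightarrow> dy"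
    and dy: "dy \<noteq> 0 \<Longrightarrow> transpose A *v dy = 0 \<and> support_fun C dy < 0"
    and dx: "dx \<noteq> 0 \<Longrightarrow> P *v dx = 0 \<and> A *v dx \<in> recession_cone C \<and> q \<bullet> dx < 0"
    using displacement_limits[OF C_prod] by blast
  have prim: "primal_infeasible A C" if "dy \<noteq> 0" using dy[OF that] by (intro primal_infeasibleI) auto
  have dual: "dual_infeasible P q A C" if "dx \<noteq> 0"
    using dx[OF that] by (intro dual_infeasibleI[OF P]) auto
  show ?thesis
  proof (rule conjI)
    show "(\<exists>xb zb yb. kkt_point P q A C xb zb yb) \<longrightarrow>
        (\<exists>xb zb yb. kkt_point P q A C xb zb yb
          \<and> x \<longlonglongrightarrow> xb \<and> z \<longlonglongrightarrow> zb \<and> y \<longlonglongrightarrow> yb)"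
    proof
      assume "\<exists>xb zb yb. kkt_point P q A C xb zb yb"
      then obtain xb zb yb where "kkt_point P q A C xb zb yb" by blast
      then show "\<exists>xb zb yb. kkt_point P q A C xb zb yb
          \<and> x \<longlonglongrightarrow> xb \<and> z \<longlonglongrightarrow> zb \<and> y \<longlonglongrightarrow> yb"
        by (rule converges_to_kkt_point)
    qed
  qed (intro exI[of _ dx] exI[of _ dy] conjI impI; use lim dx dy prim dual in simp)
qed

end
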